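(* Let $G$ be a compact connected semisimple Lie group with an $\mathrm{Ad}$-invariant inner product on $\mathfrak g$, $\eta_G$ its Cartan $3$-form, and $(M,\omega_M,\mu)$ a quasi-Hamiltonian $G$-space with relative $2$-plectic structure $\varpi=(\eta_G,\omega_M)\in\Omega^3(\mu)$. Then $\eta_G$ is nondegenerate as a $2$-plectic form on $G$ (i.e. for $u\in T_gG$, $\iota_u\eta_G=0$ implies $u=0$), and consequently weak and strong nondegeneracy of $\varpi$ coincide.
   Context: For smooth $F\colon M\to N$: $\Omega^k(F)=\Omega^k(N)\oplus\Omega^{k-1}(M)$, $d_F(\alpha,\beta)=(d\alpha,F^*\alpha-d\beta)$; an $F$-pair is $v=(v_N,v_M)$ of vector fields with $dF\circ v_M=v_N\circ F$; $\iota_v(\alpha,\beta)=(\iota_{v_N}\alpha,-\iota_{v_M}\beta)$. A closed $\varpi=(\alpha,\beta)\in\Omega^{n+1}(F)$ is weakly nondegenerate if for all $m\in M$, $w\in T_mM$: $\iota_{dF_m(w)}\alpha|_{F(m)}=0$ and $\iota_w\beta|_m=0$ imply $w=0$; it is strongly nondegenerate if for every $F$-pair $v$, $\iota_v\varpi=0$ implies $v=0$. With $\theta^L,\theta^R$ the Maurer--Cartan forms, $\eta_G=\tfrac1{12}\langle\theta^L,[\theta^L,\theta^L]\rangle$ is the bi-invariant Cartan $3$-form, so $\eta_G(X,Y,Z)$ is a nonzero constant multiple of $\langle X,[Y,Z]\rangle$ in the left trivialization. Fundamental vector fields: $v_x|_p=\frac{d}{dt}|_0\exp(-tx)\cdot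 p$. A quasi-Hamiltonian $G$-space is a $G$-manifold $M$ with an invariant $\omega_M\in\Omega^2(M)$ and a map $\mu\colon M\to G$ equivariant for conjugation such that $d\omega_M=\mu^*\eta_G$; $\iota_{v_x}\omega_M=\tfrac12\mu^*\langle\theta^L+\theta^R,x\rangle$ for all $x\in\mathfrak g$; and $\ker(\omega_M)_m\cap\ker d\mu_m=0$ for all $m$ (minimal degeneracy). *)

theory Defs
  imports "HOL-Analysis.Analysis" "HOL-Algebra.Group_Action"
begin

section \<open>Smooth manifolds\<close>

fun times_differentiable_on ::
  "nat \<Rightarrow> 'a::real_normed_vector set \<Rightarrow> ('a \<Rightarrow> 'b::real_normed_vector) \<Rightarrow> bool"
where
  "times_differentiable_on 0 S f \<longleftrightarrow> continuous_on S f"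
| "times_differentiable_on (Suc n) S f \<longleftrightarrow>
     (\<forall>x\<in>S. f differentiable (at x)) \<and>
     (\<forall>v. times_differentiable_on n S (\<lambda>x. frechet_derivative f (at x) v))"

text \<open>Used only for open \<open>S\<close> in a finite-dimensional space, where controlling all directional
  derivatives of all orders amounts to being of class $C^\infty$.\<close>
definition smooth_on :: "'a::real_normed_vector set \<Rightarrow> ('a \<Rightarrow> 'b::real_normed_vector) \<Rightarrow> bool"
  where "smooth_on S f \<longleftrightarrow> (\<forall>n. times_differentiable_on n S f)"

type_synonym ('m, 'e) chart = "'m set \<times> ('m \<Rightarrow> 'e)"

definition chart_inv :: "('m, 'e) chart \<Rightarrow> 'e \<Rightarrow> 'm"
  where "chart_inv c = inv_into (fst c) (snd c)"

text \<open>The manifold is a whole (Hausdorff, second countable) type \<open>'m\<close>, modelled on \<open>'e\<close>. The model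
  is a finite-dimensional normed space rather than a type of class \<open>euclidean_space\<close>, because the
  latter excludes dimension zero (a single point, fixed by conjugation, is a legitimate
  quasi-Hamiltonian space).\<close>
definition smooth_manifold ::
  "('m::{t2_space,second_countable_topology}, 'e::real_normed_vector) chart set \<Rightarrow> bool"
where
  "smooth_manifold A \<longleftrightarrow>
     (\<exists>B::'e set. finite B \<and> span B = UNIV) \<and>
     (\<forall>c\<in>A. open (fst c) \<and> open (snd c ` fst c) \<and>
        homeomorphism (fst c) (snd c ` fst c) (snd c) (chart_inv c)) \<and>
     (\<Union>c\<in>A. fst c) = UNIV \<and>
     (\<forall>c\<in>A. \<forall>d\<in>A. smooth_on (snd c ` (fst c \<inter> fst d)) (snd d \<circ> chart_inv c))"

definition prod_atlas :: "('m, 'e) chart set \<Rightarrow> ('n, 'f) chart set \<Rightarrow> ('m \<times> 'n, 'e \<times> 'f) chart set"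
  where "prod_atlas A B = {(fst c \<times> fst d, map_prod (snd c) (snd d)) | c d. c \<in> A \<and> d \<in> B}"

definition real_atlas :: "(real, real) chart set"
  where "real_atlas = {(UNIV, id)}"

definition smooth_map ::
  "('m::topological_space, 'e::real_normed_vector) chart set \<Rightarrow>
   ('n::topological_space, 'f::real_normed_vector) chart set \<Rightarrow> ('m \<Rightarrow> 'n) \<Rightarrow> bool"
where
  "smooth_map A B F \<longleftrightarrow> continuous_on UNIV F \<and>
     (\<forall>c\<in>A. \<forall>d\<in>B. smooth_on (snd c ` (fst c \<inter> F -` fst d)) (snd d \<circ> F \<circ> chart_inv c))"


section \<open>Tangent vectors, vector fields and differential forms\<close>

text \<open>A preferred chart is chosen around every point \<open>p\<close>, and the tangent space $T_pM$ is identified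
  with the model space \<open>'e\<close> through it; thus vector fields have type \<open>'m \<Rightarrow> 'e\<close>. Preferred charts of
  different points are unrelated, so smoothness and derivatives of fields and forms are always
  taken after transporting to one common chart.\<close>
definition chart_at :: "('m, 'e) chart set \<Rightarrow> 'm \<Rightarrow> ('m, 'e) chart"
  where "chart_at A p = (SOME c. c \<in> A \<and> p \<in> fst c)"

text \<open>The tangent map $dF_p : T_pM \to T_{F(p)}N$.\<close>
definition mderiv ::
  "('m, 'e::real_normed_vector) chart set \<Rightarrow> ('n, 'f::real_normed_vector) chart set \<Rightarrow>
   ('m \<Rightarrow> 'n) \<Rightarrow> 'm \<Rightarrow> 'e \<Rightarrow> 'f"
where
  "mderiv A B F p =
     frechet_derivative (snd (chart_at B (F p)) \<circ> F \<circ> chart_inv (chart_at A p))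
       (at (snd (chart_at A p) p))"

text \<open>The derivatives of the chart \<open>c\<close> at \<open>p\<close>, as a map $T_pM \to\;$\<open>'e\<close>, and of its inverse at \<open>x\<close>.\<close>
definition to_chart ::
  "('m, 'e::real_normed_vector) chart set \<Rightarrow> ('m, 'e) chart \<Rightarrow> 'm \<Rightarrow> 'e \<Rightarrow> 'e"
where
  "to_chart A c p =
     frechet_derivative (snd c \<circ> chart_inv (chart_at A p)) (at (snd (chart_at A p) p))"

definition from_chart ::
  "('m, 'e::real_normed_vector) chart set \<Rightarrow> ('m, 'e) chart \<Rightarrow> 'e \<Rightarrow> 'e \<Rightarrow> 'e"
where
  "from_chart A c x =
     frechet_derivative (snd (chart_at A (chart_inv c x)) \<circ> chart_inv c) (at x)"

definition field_rep ::
  "('m, 'e::real_normed_vector) chart set \<Rightarrow> ('m, 'e) chart \<Rightarrow> ('m \<Rightarrow> 'e) \<Rightarrow> 'e \<Rightarrow> 'e"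
  where "field_rep A c X x = to_chart A c (chart_inv c x) (X (chart_inv c x))"

definition smooth_field :: "('m, 'e::real_normed_vector) chart set \<Rightarrow> ('m \<Rightarrow> 'e) \<Rightarrow> bool"
  where "smooth_field A X \<longleftrightarrow> (\<forall>c\<in>A. smooth_on (snd c ` fst c) (field_rep A c X))"

text \<open>$[X,Y]_p = D\tilde Y(\tilde X) - D\tilde X(\tilde Y)$ in the chart that identifies $T_pM$ with
  the model space.\<close>
definition field_bracket ::
  "('m, 'e::real_normed_vector) chart set \<Rightarrow> ('m \<Rightarrow> 'e) \<Rightarrow> ('m \<Rightarrow> 'e) \<Rightarrow> 'm \<Rightarrow> 'e"
where
  "field_bracket A X Y p =
     (let c = chart_at A p in
        frechet_derivative (field_rep A c Y) (at (snd c p)) (X p)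
      - frechet_derivative (field_rep A c X) (at (snd c p)) (Y p))"

text \<open>A $k$-form takes a point and the list of its $k$ arguments; it is required to vanish on lists of
  any other length, so that equality of forms is equality of functions.\<close>
type_synonym ('m, 'e) form = "'m \<Rightarrow> 'e list \<Rightarrow> real"

definition alternating_multilinear :: "nat \<Rightarrow> ('e::real_vector list \<Rightarrow> real) \<Rightarrow> bool"
where
  "alternating_multilinear k f \<longleftrightarrow>
     (\<forall>vs. length vs \<noteq> k \<longrightarrow> f vs = 0) \<and>
     (\<forall>us vs. length us + length vs + 1 = k \<longrightarrow> linear (\<lambda>v. f (us @ v # vs))) \<and>
     (\<forall>vs. \<not> distinct vs \<longrightarrow> f vs = 0)"

definition form_rep ::
  "('m, 'e::real_normed_vector) chart set \<Rightarrow> ('m, 'e) chart \<Rightarrow> ('m, 'e) form \<Rightarrow> 'e \<Rightarrow> 'e list \<Rightarrow> real"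
  where "form_rep A c \<alpha> x vs = \<alpha> (chart_inv c x) (map (from_chart A c x) vs)"

definition diff_form ::
  "('m, 'e::real_normed_vector) chart set \<Rightarrow> nat \<Rightarrow> ('m, 'e) form \<Rightarrow> bool"
where
  "diff_form A k \<alpha> \<longleftrightarrow> (\<forall>p. alternating_multilinear k (\<alpha> p)) \<and>
     (\<forall>c\<in>A. \<forall>vs. smooth_on (snd c ` fst c) (\<lambda>x. form_rep A c \<alpha> x vs))"

text \<open>$(d\alpha)(v_0,\dots,v_k) = \sum_i (-1)^i\, D_{v_i}\,
  \tilde\alpha(v_0,\dots,\widehat{v_i},\dots,v_k)$ in the chart that identifies $T_pM$ with the
  model space.\<close>
definition ext_deriv ::
  "('m, 'e::real_normed_vector) chart set \<Rightarrow> ('m, 'e) form \<Rightarrow> ('m, 'e) form"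
where
  "ext_deriv A \<alpha> p vs =
     (let c = chart_at A p in
      \<Sum>i<length vs. (- 1) ^ i *
        frechet_derivative (\<lambda>x. form_rep A c \<alpha> x (take i vs @ drop (Suc i) vs))
          (at (snd c p)) (vs ! i))"

definition pullback ::
  "('m, 'e::real_normed_vector) chart set \<Rightarrow> ('n, 'f::real_normed_vector) chart set \<Rightarrow>
   ('m \<Rightarrow> 'n) \<Rightarrow> ('n, 'f) form \<Rightarrow> ('m, 'e) form"
  where "pullback A B F \<alpha> p vs = \<alpha> (F p) (map (mderiv A B F p) vs)"

definition contract :: "('m \<Rightarrow> 'e) \<Rightarrow> ('m, 'e) form \<Rightarrow> ('m, 'e) form"
  where "contract X \<alpha> p vs = \<alpha> p (X p # vs)"


section \<open>Relative forms of a smooth map\<close>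

type_synonym ('m, 'e, 'n, 'f) rel_form = "('n, 'f) form \<times> ('m, 'e) form"

definition rel_pair ::
  "('m, 'e::real_normed_vector) chart set \<Rightarrow> ('n, 'f::real_normed_vector) chart set \<Rightarrow>
   ('m \<Rightarrow> 'n) \<Rightarrow> ('n \<Rightarrow> 'f) \<times> ('m \<Rightarrow> 'e) \<Rightarrow> bool"
where
  "rel_pair A B F v \<longleftrightarrow> smooth_field B (fst v) \<and> smooth_field A (snd v) \<and>
     (\<forall>m. mderiv A B F m (snd v m) = fst v (F m))"

definition rel_contract ::
  "('n \<Rightarrow> 'f) \<times> ('m \<Rightarrow> 'e) \<Rightarrow> ('m, 'e, 'n, 'f) rel_form \<Rightarrow> ('m, 'e, 'n, 'f) rel_form"
  where "rel_contract v \<omega> =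
    (contract (fst v) (fst \<omega>), (\<lambda>m vs. - contract (snd v) (snd \<omega>) m vs))"

text \<open>Both nondegeneracy notions are applied to closed relative forms. They are pointwise conditions
  on the pair of forms in which closedness plays no role, so it is not repeated in them; for
  $(\eta_G,\omega_M)$ it is a consequence of $d\omega_M=\mu^*\eta_G$ and $d\eta_G=0$.\<close>
definition weakly_nondegenerate ::
  "('m, 'e::real_normed_vector) chart set \<Rightarrow> ('n, 'f::real_normed_vector) chart set \<Rightarrow>
   ('m \<Rightarrow> 'n) \<Rightarrow> ('m, 'e, 'n, 'f) rel_form \<Rightarrow> bool"
where
  "weakly_nondegenerate A B F \<omega> \<longleftrightarrow>
     (\<forall>m w. (\<forall>vs. fst \<omega> (F m) (mderiv A B F m w # vs) = 0) \<and>
            (\<forall>vs. snd \<omega> m (w # vs) = 0) \<longrightarrow> w = 0)"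

definition strongly_nondegenerate ::
  "('m, 'e::real_normed_vector) chart set \<Rightarrow> ('n, 'f::real_normed_vector) chart set \<Rightarrow>
   ('m \<Rightarrow> 'n) \<Rightarrow> ('m, 'e, 'n, 'f) rel_form \<Rightarrow> bool"
where
  "strongly_nondegenerate A B F \<omega> \<longleftrightarrow>
     (\<forall>v. rel_pair A B F v \<and> rel_contract v \<omega> = ((\<lambda>_ _. 0), (\<lambda>_ _. 0)) \<longrightarrow>
          v = ((\<lambda>_. 0), (\<lambda>_. 0)))"

definition nondegenerate_form :: "('m, 'e::real_normed_vector) form \<Rightarrow> bool"
  where "nondegenerate_form \<alpha> \<longleftrightarrow> (\<forall>p u. (\<forall>vs. \<alpha> p (u # vs) = 0) \<longrightarrow> u = 0)"


section \<open>Lie groups\<close>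

definition lie_group ::
  "'g::{t2_space,second_countable_topology} monoid \<Rightarrow> ('g, 'a::real_normed_vector) chart set \<Rightarrow> bool"
where
  "lie_group G A \<longleftrightarrow> group G \<and> carrier G = UNIV \<and> smooth_manifold A \<and>
     smooth_map (prod_atlas A A) A (\<lambda>(g, h). g \<otimes>\<^bsub>G\<^esub> h) \<and>
     smooth_map A A (\<lambda>g. inv\<^bsub>G\<^esub> g)"

text \<open>The Lie algebra is the tangent space \<open>'a\<close> at the unit, with the bracket of left-invariant
  vector fields.\<close>
definition left_inv_field ::
  "'g monoid \<Rightarrow> ('g, 'a::real_normed_vector) chart set \<Rightarrow> 'a \<Rightarrow> 'g \<Rightarrow> 'a"
  where "left_inv_field G A x g = mderiv A A (\<lambda>h. g \<otimes>\<^bsub>G\<^esub> h) \<one>\<^bsub>G\<^esub> x"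

definition lie_bracket ::
  "'g monoid \<Rightarrow> ('g, 'a::real_normed_vector) chart set \<Rightarrow> 'a \<Rightarrow> 'a \<Rightarrow> 'a"
where
  "lie_bracket G A x y =
     field_bracket A (left_inv_field G A x) (left_inv_field G A y) \<one>\<^bsub>G\<^esub>"

definition Ad :: "'g monoid \<Rightarrow> ('g, 'a::real_normed_vector) chart set \<Rightarrow> 'g \<Rightarrow> 'a \<Rightarrow> 'a"
  where "Ad G A g = mderiv A A (\<lambda>h. g \<otimes>\<^bsub>G\<^esub> h \<otimes>\<^bsub>G\<^esub> inv\<^bsub>G\<^esub> g) \<one>\<^bsub>G\<^esub>"

definition lie_ideal ::
  "'g monoid \<Rightarrow> ('g, 'a::real_normed_vector) chart set \<Rightarrow> 'a set \<Rightarrow> bool"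
where
  "lie_ideal G A I \<longleftrightarrow> subspace I \<and> (\<forall>x. \<forall>y\<in>I. lie_bracket G A x y \<in> I)"

primrec derived_series ::
  "'g monoid \<Rightarrow> ('g, 'a::real_normed_vector) chart set \<Rightarrow> 'a set \<Rightarrow> nat \<Rightarrow> 'a set"
where
  "derived_series G A I 0 = I"
| "derived_series G A I (Suc n) =
     span {lie_bracket G A x y | x y. x \<in> derived_series G A I n \<and> y \<in> derived_series G A I n}"

definition semisimple :: "'g monoid \<Rightarrow> ('g, 'a::real_normed_vector) chart set \<Rightarrow> bool"
where
  "semisimple G A \<longleftrightarrow>
     (\<forall>I. lie_ideal G A I \<and> (\<exists>n. derived_series G A I n = {0}) \<longrightarrow> I = {0})"

definition Ad_invariant_inner_product ::
  "'g monoid \<Rightarrow> ('g, 'a::real_normed_vector) chart set \<Rightarrow> ('a \<Rightarrow> 'a \<Rightarrow> real) \<Rightarrow> bool"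
where
  "Ad_invariant_inner_product G A ip \<longleftrightarrow>
     bilinear ip \<and> (\<forall>x y. ip x y = ip y x) \<and> (\<forall>x. x \<noteq> 0 \<longrightarrow> ip x x > 0) \<and>
     (\<forall>g x y. ip (Ad G A g x) (Ad G A g y) = ip x y)"

definition one_parameter_subgroup ::
  "'g::topological_space monoid \<Rightarrow> ('g, 'a::real_normed_vector) chart set \<Rightarrow> (real \<Rightarrow> 'g) \<Rightarrow> bool"
where
  "one_parameter_subgroup G A \<gamma> \<longleftrightarrow>
     smooth_map real_atlas A \<gamma> \<and> (\<forall>s t. \<gamma> (s + t) = \<gamma> s \<otimes>\<^bsub>G\<^esub> \<gamma> t)"

definition velocity :: "('m, 'e::real_normed_vector) chart set \<Rightarrow> (real \<Rightarrow> 'm) \<Rightarrow> real \<Rightarrow> 'e"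
  where "velocity A \<gamma> t = mderiv real_atlas A \<gamma> t 1"

definition lie_exp ::
  "'g::topological_space monoid \<Rightarrow> ('g, 'a::real_normed_vector) chart set \<Rightarrow> 'a \<Rightarrow> 'g"
  where "lie_exp G A x = (THE \<gamma>. one_parameter_subgroup G A \<gamma> \<and> velocity A \<gamma> 0 = x) 1"

definition theta_L ::
  "'g monoid \<Rightarrow> ('g, 'a::real_normed_vector) chart set \<Rightarrow> 'g \<Rightarrow> 'a \<Rightarrow> 'a"
  where "theta_L G A g = mderiv A A (\<lambda>h. inv\<^bsub>G\<^esub> g \<otimes>\<^bsub>G\<^esub> h) g"

definition theta_R ::
  "'g monoid \<Rightarrow> ('g, 'a::real_normed_vector) chart set \<Rightarrow> 'g \<Rightarrow> 'a \<Rightarrow> 'a"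
  where "theta_R G A g = mderiv A A (\<lambda>h. h \<otimes>\<^bsub>G\<^esub> inv\<^bsub>G\<^esub> g) g"

text \<open>$[\theta^L,\theta^L](u,v) = [\theta^L u,\theta^L v] - [\theta^L v,\theta^L u]$, the wedge product
  combined with the bracket.\<close>
definition theta_bracket ::
  "'g monoid \<Rightarrow> ('g, 'a::real_normed_vector) chart set \<Rightarrow> 'g \<Rightarrow> 'a \<Rightarrow> 'a \<Rightarrow> 'a"
where
  "theta_bracket G A g u v =
     lie_bracket G A (theta_L G A g u) (theta_L G A g v)
   - lie_bracket G A (theta_L G A g v) (theta_L G A g u)"

text \<open>$\eta_G = \frac1{12}\langle\theta^L,[\theta^L,\theta^L]\rangle$, the pairing being combined with the
  wedge product of a 1-form and a 2-form,
  $(\alpha\wedge\beta)(u,v,w) = \alpha(u)\beta(v,w)+\alpha(v)\beta(w,u)+\alpha(w)\beta(u,v)$.\<close>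
definition cartan_form ::
  "'g monoid \<Rightarrow> ('g, 'a::real_normed_vector) chart set \<Rightarrow> ('a \<Rightarrow> 'a \<Rightarrow> real) \<Rightarrow> ('g, 'a) form"
where
  "cartan_form G A ip g us = (case us of
      [u, v, w] \<Rightarrow> 1 / 12 *
        (ip (theta_L G A g u) (theta_bracket G A g v w)
       + ip (theta_L G A g v) (theta_bracket G A g w u)
       + ip (theta_L G A g w) (theta_bracket G A g u v))
    | _ \<Rightarrow> 0)"

text \<open>The 1-form $\frac12\langle\theta^L+\theta^R,x\rangle$.\<close>
definition theta_pairing ::
  "'g monoid \<Rightarrow> ('g, 'a::real_normed_vector) chart set \<Rightarrow> ('a \<Rightarrow> 'a \<Rightarrow> real) \<Rightarrow> 'a \<Rightarrow> ('g, 'a) form"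
where
  "theta_pairing G A ip x g us = (case us of
      [u] \<Rightarrow> 1 / 2 * ip (theta_L G A g u + theta_R G A g u) x
    | _ \<Rightarrow> 0)"


section \<open>Quasi-Hamiltonian spaces\<close>

definition fundamental_field ::
  "'g::topological_space monoid \<Rightarrow> ('g, 'a::real_normed_vector) chart set \<Rightarrow>
   ('m, 'e::real_normed_vector) chart set \<Rightarrow> ('g \<Rightarrow> 'm \<Rightarrow> 'm) \<Rightarrow> 'a \<Rightarrow> 'm \<Rightarrow> 'e"
where
  "fundamental_field G A B act x p = velocity B (\<lambda>t. act (lie_exp G A (- t *\<^sub>R x)) p) 0"

definition quasi_hamiltonian ::
  "'g::{t2_space,second_countable_topology} monoid \<Rightarrow> ('g, 'a::real_normed_vector) chart set \<Rightarrow>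
   ('a \<Rightarrow> 'a \<Rightarrow> real) \<Rightarrow>
   ('m::{t2_space,second_countable_topology}, 'e::real_normed_vector) chart set \<Rightarrow>
   ('g \<Rightarrow> 'm \<Rightarrow> 'm) \<Rightarrow> ('m, 'e) form \<Rightarrow> ('m \<Rightarrow> 'g) \<Rightarrow> bool"
where
  "quasi_hamiltonian G A ip B act \<omega> \<mu> \<longleftrightarrow>
     smooth_manifold B \<and>
     group_action G UNIV act \<and> smooth_map (prod_atlas A B) B (\<lambda>(g, p). act g p) \<and>
     diff_form B 2 \<omega> \<and> (\<forall>g. pullback B B (act g) \<omega> = \<omega>) \<and>
     smooth_map B A \<mu> \<and> (\<forall>g p. \<mu> (act g p) = g \<otimes>\<^bsub>G\<^esub> \<mu> p \<otimes>\<^bsub>G\<^esub> inv\<^bsub>G\<^esub> g) \<and>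
     ext_deriv B \<omega> = pullback B A \<mu> (cartan_form G A ip) \<and>
     (\<forall>x. contract (fundamental_field G A B act x) \<omega> =
          pullback B A \<mu> (theta_pairing G A ip x)) \<and>
     (\<forall>p. {w. \<forall>vs. \<omega> p (w # vs) = 0} \<inter> {w. mderiv B A \<mu> p w = 0} = {0})"

end

theory Submission
  imports Defs
begin

text \<open>Only the nondegeneracy of $\eta_G$ requires work. Once it is known, minimal degeneracy of $\omega_M$
  gives weak as well as strong nondegeneracy of $(\eta_G,\omega_M)$: if
  $\iota_{d\mu(w)}\eta_G=0$, then $d\mu(w)=0$, and $\iota_w\omega_M=0$ puts $w$ in
  $\ker d\mu\cap\ker\omega_M=0$; an $F$-pair is treated
  pointwise in the same way. The equivalence thus holds because both sides are true
  (\<open>strongly_and_weakly_nondegenerate_if_kernels_meet_trivially\<close>).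

  If $X,Y,Z$ are the values of $\theta^L$ on $u,v,w$, then
  $\eta_G(u,v,w)=\frac12\langle X,[Y,Z]\rangle$ (\<open>cartan_form_eq\<close>). A
  vector $X$ orthogonal to all brackets is central, since
  $\langle[Y,X],Z\rangle=-\langle X,[Y,Z]\rangle$, and a semisimple Lie algebra has no nonzero
  central element (\<open>central_element_eq_0\<close>). Everything therefore rests on the skew-adjointness of the
  bracket (\<open>lie_bracket_skew_adjoint\<close>), the infinitesimal form of $\mathrm{Ad}$-invariance.

  To pass from the group to the bracket, $d(\mathrm{Ad})_1(z)x=[z,x]$ is proved in one chart around the
  unit (\<open>Ad_has_vector_derivative\<close>). If $H$ is the mixed second derivative of the multiplication at
  the unit, the bracket of left-invariant fields is $[x,y]=H(x,y)-H(y,x)$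
  (\<open>lie_bracket_eq_hessian\<close>). On the other hand $\mathrm{Ad}_g x$ solves the linear equation obtained
  by differentiating $(ghg^{-1})g=gh$ in $h$ (\<open>Ad_translation_equation\<close>); differentiating this equation
  in $g$ yields $H(z,x)-H(x,z)$ (\<open>has_vector_derivative_solution_of_linear_equation\<close>). Schwarz's
  theorem (\<open>mixed_derivatives_commute\<close>) identifies the Hessians that arise in the two computations.\<close>

section \<open>Bounded coordinates in finite-dimensional normed spaces\<close>

text \<open>The model space of a manifold is only known to be a normed space with a finite spanning set, so
  the equivalence of its norm with the $\ell^1$-norm of coordinates has to be derived. The set of
  coefficient families supported on $B$ with $\ell^1$-norm 1 is compact in the product topology, and
  the norm of the linear combination does not vanish on it by independence; so it has a positive
  minimum there, whose inverse is the constant $K$.\<close>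
lemma finite_independent_norm_lower_bound:
  fixes B :: "'a::real_normed_vector set"
  assumes fin: "finite B" and ind: "independent B"
  obtains K where "K > 0" "\<And>a. (\<Sum>b\<in>B. \<bar>a b\<bar>) \<le> K * norm (\<Sum>b\<in>B. a b *\<^sub>R b)"
proof (cases "B = {}")
  case True
  then show ?thesis using that[of 1] by simp
next
  case False
  let ?N = "\<lambda>a::'a \<Rightarrow> real. norm (\<Sum>b\<in>B. a b *\<^sub>R b)" and ?s = "\<lambda>a::'a \<Rightarrow> real. \<Sum>b\<in>B. \<bar>a b\<bar>"
  define Q where "Q = PiE UNIV (\<lambda>b. if b \<in> B then {-1..1::real} else {0})"
  have "compactin (product_topology (\<lambda>_. euclidean) UNIV) Q"
    unfolding Q_def by (subst compactin_PiE) (simp add: compact_Icc)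
  then have "compact Q"
    by (simp add: euclidean_product_topology)
  moreover have "continuous_on UNIV ?s"
    by (intro continuous_intros continuous_on_product_coordinates)
  then have "closed (?s -` {1})"
    by (intro closed_vimage closed_singleton)
  ultimately have "compact (Q \<inter> ?s -` {1})"
    by (rule compact_Int_closed)
  moreover obtain b0 where b0: "b0 \<in> B"
    using False by blast
  have "(\<lambda>b. if b = b0 then 1 else 0) \<in> Q \<inter> ?s -` {1}"
    using b0 fin by (auto simp: Q_def if_distrib[of abs] cong: if_cong)
  then have "Q \<inter> ?s -` {1} \<noteq> {}"
    by blast
  moreover have "continuous_on (Q \<inter> ?s -` {1}) ?N"
    by (intro continuous_intros continuous_on_subset[OF continuous_on_product_coordinates]) auto
  ultimately obtain m where m: "m \<in> Q" "?s m = 1" "\<And>a. a \<in> Q \<Longrightarrow> ?s a = 1 \<Longrightarrow> ?N m \<le> ?N a"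
    by (blast dest: continuous_attains_inf)
  have "?N m \<noteq> 0"
  proof
    assume "?N m = 0"
    then have "m b = 0" if "b \<in> B" for b
      using ind fin that by (auto simp: independent_explicit_finite_subsets)
    then show False using m(2) by simp
  qed
  then have pos: "?N m > 0" by simp
  show ?thesis
  proof (rule that[of "1 / ?N m"])
    show "1 / ?N m > 0" using pos by simp
    fix a :: "'a \<Rightarrow> real"
    show "?s a \<le> 1 / ?N m * ?N a"
    proof (cases "?s a = 0")
      case True
      then show ?thesis using pos by simp
    next
      case False
      then have s: "?s a > 0"
        by (simp add: sum_nonneg order_neq_le_trans)
      define a' where "a' = (\<lambda>b. if b \<in> B then a b / ?s a else 0)"
      have "\<bar>a b\<bar> \<le> ?s a" if "b \<in> B" for b
        using fin that by (intro member_le_sum) auto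
      then have "\<bar>a b / ?s a\<bar> \<le> 1" if "b \<in> B" for b
        using s that by (simp add: abs_divide)
      then have "a' b \<in> (if b \<in> B then {-1..1} else {0})" for b
        unfolding a'_def by (metis abs_le_iff atLeastAtMost_iff minus_le_iff singletonI)
      then have "a' \<in> Q"
        by (simp add: Q_def PiE_iff)
      moreover have "?s a' = 1"
        using s by (simp add: a'_def abs_divide flip: sum_divide_distrib)
      ultimately have "?N m \<le> ?N a'"
        by (rule m(3))
      also have "(\<Sum>b\<in>B. a' b *\<^sub>R b) = (1 / ?s a) *\<^sub>R (\<Sum>b\<in>B. a b *\<^sub>R b)"
        by (simp add: a'_def scaleR_sum_right divide_inverse_commute)
      also have "norm \<dots> = ?N a / ?s a"
        using s by simp
      finally show ?thesis
        using s pos by (simp add: field_simps)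
    qed
  qed
qed

text \<open>This makes linear algebra on the model space continuous: every limit or derivative of a linear or
  bilinear expression can be computed one coordinate at a time.\<close>
lemma finite_span_bounded_coordinates:
  fixes B0 :: "'a::real_normed_vector set"
  assumes "finite B0" and "span B0 = UNIV"
  obtains B and r :: "'a \<Rightarrow> 'a \<Rightarrow> real"
  where "finite B" "\<And>b. bounded_linear (r b)" "\<And>v. (\<Sum>b\<in>B. r b v *\<^sub>R b) = v"
proof -
  obtain B where B: "B \<subseteq> B0" "independent B" "B0 \<subseteq> span B"
    using maximal_independent_subset by blast
  have fin: "finite B"
    using B(1) assms(1) finite_subset by blast
  have sp: "span B = UNIV"
    using B(3) assms(2) by (metis span_mono span_span top.extremum_uniqueI)
  define r where "r b v = (if b \<in> B then representation B v b else 0)" for b v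
  have sumr: "(\<Sum>b\<in>B. r b v *\<^sub>R b) = v" for v
    using sum_representation_eq[OF B(2), of v B] fin sp by (simp add: r_def)
  obtain K where K: "K > 0" "\<And>a. (\<Sum>b\<in>B. \<bar>a b\<bar>) \<le> K * norm (\<Sum>b\<in>B. a b *\<^sub>R b)"
    using finite_independent_norm_lower_bound[OF fin B(2)] by metis
  have "bounded_linear (r b)" for b
  proof (cases "b \<in> B")
    case True
    have "norm (r b v) \<le> norm v * K" for v
    proof -
      have "\<bar>r b v\<bar> \<le> (\<Sum>b\<in>B. \<bar>r b v\<bar>)"
        using fin True by (intro member_le_sum) auto
      also have "\<dots> \<le> K * norm v"
        using K(2)[of "\<lambda>b. r b v"] sumr[of v] by simp
      finally show ?thesis by (simp add: mult.commute)
    qed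
    then show ?thesis
      using True B(2) sp
      by (intro bounded_linear_intro[where K=K]) (auto simp: r_def representation_add representation_scale)
  next
    case False
    then have "r b = (\<lambda>_. 0)" by (auto simp: r_def)
    then show ?thesis by simp
  qed
  with fin sumr show ?thesis using that by blast
qed

lemma linear_sum_coordinates:
  assumes "linear f" "(\<Sum>b\<in>B. r b v *\<^sub>R b) = v"
  shows "f v = (\<Sum>b\<in>B. r b v *\<^sub>R f b)"
proof -
  have "f v = f (\<Sum>b\<in>B. r b v *\<^sub>R b)"
    by (simp only: assms(2))
  also have "\<dots> = (\<Sum>b\<in>B. r b v *\<^sub>R f b)"
    by (simp add: linear_sum[OF assms(1)] linear_scale[OF assms(1)])
  finally show ?thesis .
qed

section \<open>Derivatives of implicitly given curves and mixed second derivatives\<close>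

lemma has_vector_derivative_iff_quotient_tendsto:
  "(f has_vector_derivative D) (at x) \<longleftrightarrow> ((\<lambda>t. (f (x + t) - f x) /\<^sub>R t) \<longlongrightarrow> D) (at 0)"
proof -
  have eq: "norm (f (x + t) - f x - t *\<^sub>R D) / norm t = norm ((f (x + t) - f x) /\<^sub>R t - D)" if "t \<noteq> 0" for t
  proof -
    have "(f (x + t) - f x) /\<^sub>R t - D = (f (x + t) - f x - t *\<^sub>R D) /\<^sub>R t"
      using that by (simp add: scaleR_diff_right)
    then show ?thesis by (simp add: divide_inverse_commute)
  qed
  have "(f has_vector_derivative D) (at x) \<longleftrightarrow>
      ((\<lambda>t. norm (f (x + t) - f x - t *\<^sub>R D) / norm t) \<longlongrightarrow> 0) (at 0)"
    by (simp add: has_vector_derivative_def has_derivative_at bounded_linear_scaleR_left)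
  also have "\<dots> \<longleftrightarrow> ((\<lambda>t. norm ((f (x + t) - f x) /\<^sub>R t - D)) \<longlongrightarrow> 0) (at 0)"
    by (intro filterlim_cong refl) (use eq in \<open>simp add: eventually_at_filter\<close>)
  also have "\<dots> \<longleftrightarrow> ((\<lambda>t. (f (x + t) - f x) /\<^sub>R t) \<longlongrightarrow> D) (at 0)"
    by (simp add: tendsto_norm_zero_iff LIM_zero_iff)
  finally show ?thesis .
qed

text \<open>Differentiating $R_t a_t = l_t$ at $t=0$ with $R_0=\mathrm{id}$ gives $a' + R'(a_0) = l'$ once $a$
  is differentiable, and the equation itself forces that: $R_t\to\mathrm{id}$ in operator norm because this holds on a finite basis, so $a_t$ is
  bounded by $2|l_t|$, hence continuous at $0$, and then
  $(a_t-a_0)/t = (l_t-l_0)/t - \sum_b a_t^b\,(R_t b-b)/t$ has a limit. It is used to differentiate the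
  adjoint representation without differentiating the inverse of the group.\<close>
lemma has_vector_derivative_solution_of_linear_equation:
  fixes R :: "real \<Rightarrow> 'a::real_normed_vector \<Rightarrow> 'a"
  assumes "finite B0" and "span B0 = (UNIV :: 'a set)"
    and linR: "\<forall>\<^sub>F t in at 0. linear (R t)" and R0: "\<And>v. R 0 v = v"
    and dR: "\<And>v. ((\<lambda>t. R t v) has_vector_derivative R' v) (at 0)"
    and dl: "(l has_vector_derivative l') (at 0)"
    and eq: "\<forall>\<^sub>F t in at 0. R t (a t) = l t"
    and a0: "a 0 = x" "l 0 = x"
  shows "(a has_vector_derivative (l' - R' x)) (at 0)"
proof -
  obtain B and r :: "'a \<Rightarrow> 'a \<Rightarrow> real"
    where fin: "finite B" and r: "\<And>b. bounded_linear (r b)" and rs: "\<And>v. (\<Sum>b\<in>B. r b v *\<^sub>R b) = v"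
    using finite_span_bounded_coordinates[OF assms(1,2)] by blast
  \<comment> \<open>\<open>d\<close> measures how far \<open>R t\<close> is from the identity on the basis, and \<open>\<delta>\<close> below bounds the
    operator norm of \<open>R t - id\<close>.\<close>
  define d where "d b t = R t b - b" for b t
  have ev: "\<forall>\<^sub>F t in at 0. \<forall>v. R t v - v = (\<Sum>b\<in>B. r b v *\<^sub>R d b t)"
  proof (use linR in eventually_elim, intro allI)
    fix t v assume "linear (R t)"
    then have "linear (\<lambda>w. R t w - w)"
      by (intro linear_compose_sub) (auto simp: linear_iff)
    then have "R t v - v = (\<Sum>b\<in>B. r b v *\<^sub>R (R t b - b))"
      by (rule linear_sum_coordinates) (rule rs)
    then show "R t v - v = (\<Sum>b\<in>B. r b v *\<^sub>R d b t)"
      by (simp add: d_def)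
  qed
  have dlim: "((\<lambda>t. d b t /\<^sub>R t) \<longlongrightarrow> R' b) (at 0)" for b
    using dR[of b] by (simp add: has_vector_derivative_iff_quotient_tendsto R0 d_def)
  have llim: "((\<lambda>t. (l t - x) /\<^sub>R t) \<longlongrightarrow> l') (at 0)"
    using dl by (simp add: has_vector_derivative_iff_quotient_tendsto a0)
  have d0: "(d b \<longlongrightarrow> 0) (at 0)" for b
  proof -
    have "isCont (\<lambda>t. R t b) 0"
      using dR[of b] has_vector_derivative_continuous by blast
    then show ?thesis
      unfolding d_def by (auto simp: isCont_def R0 LIM_zero_iff)
  qed
  have l0: "(l \<longlongrightarrow> x) (at 0)"
    using has_vector_derivative_continuous[OF dl] by (simp add: isCont_def a0)
  have "\<forall>b. \<exists>K. \<forall>v. norm (r b v) \<le> norm v * K"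
    using r bounded_linear.bounded by blast
  then obtain K where K: "\<And>b v. norm (r b v) \<le> norm v * K b"
    by metis
  define \<delta> where "\<delta> t = (\<Sum>b\<in>B. K b * norm (d b t))" for t
  have "(\<delta> \<longlongrightarrow> (\<Sum>b\<in>B. K b * norm (0::'a))) (at 0)"
    unfolding \<delta>_def by (intro tendsto_intros d0)
  then have \<delta>0: "(\<delta> \<longlongrightarrow> 0) (at 0)" by simp
  have bd: "\<forall>\<^sub>F t in at 0. \<forall>v. norm (R t v - v) \<le> norm v * \<delta> t"
    using ev
  proof eventually_elim
    fix t assume *: "\<forall>v. R t v - v = (\<Sum>b\<in>B. r b v *\<^sub>R d b t)"
    have "norm (\<Sum>b\<in>B. r b v *\<^sub>R d b t) \<le> (\<Sum>b\<in>B. norm v * K b * norm (d b t))" for v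
      using K by (intro sum_norm_le) (auto simp: mult_right_mono)
    then show "\<forall>v. norm (R t v - v) \<le> norm v * \<delta> t"
      using * by (simp add: \<delta>_def sum_distrib_left mult.assoc)
  qed
  have "\<forall>\<^sub>F t in at 0. \<delta> t < 1/2"
    using \<delta>0 by (rule order_tendstoD) simp
  then have "\<forall>\<^sub>F t in at 0. norm (a t - l t) \<le> norm (2 * norm (l t) * \<delta> t)"
    using bd eq
  proof eventually_elim
    case (elim t)
    then have 1: "norm (l t - a t) \<le> norm (a t) * \<delta> t"
      using elim(2)[rule_format, of "a t"] elim(3) by simp
    moreover have "norm (a t) * \<delta> t \<le> norm (a t) * (1/2)"
      using elim(1) by (intro mult_left_mono) auto
    ultimately have "norm (a t) \<le> 2 * norm (l t)"
      using norm_triangle_ineq2[of "a t" "l t"] by (simp add: norm_minus_commute)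
    moreover have "norm (a t) * \<delta> t \<ge> 0"
      using 1 by (rule order_trans[OF norm_ge_zero])
    ultimately have "norm (a t) * \<delta> t \<le> norm (2 * norm (l t) * \<delta> t)"
      by (smt (verit) mult_right_mono norm_mult norm_ge_zero real_norm_def mult_nonneg_nonneg abs_mult)
    with 1 show ?case by (simp add: norm_minus_commute)
  qed
  moreover have "((\<lambda>t. 2 * norm (l t) * \<delta> t) \<longlongrightarrow> 2 * norm x * 0) (at 0)"
    by (intro tendsto_intros l0 \<delta>0)
  then have "((\<lambda>t. 2 * norm (l t) * \<delta> t) \<longlongrightarrow> 0) (at 0)" by simp
  ultimately have "((\<lambda>t. a t - l t) \<longlongrightarrow> 0) (at 0)"
    using tendsto_0_le[where K=1] by (metis (no_types, lifting) eventually_mono mult.right_neutral)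
  from tendsto_add[OF this l0] have alim: "(a \<longlongrightarrow> x) (at 0)" by simp
  have "((\<lambda>t. (l t - x) /\<^sub>R t - (\<Sum>b\<in>B. r b (a t) *\<^sub>R (d b t /\<^sub>R t))) \<longlongrightarrow>
      l' - (\<Sum>b\<in>B. r b x *\<^sub>R R' b)) (at 0)"
    by (intro tendsto_intros llim dlim bounded_linear.tendsto[OF r] alim)
  moreover have "\<forall>\<^sub>F t in at 0. (l t - x) /\<^sub>R t - (\<Sum>b\<in>B. r b (a t) *\<^sub>R (d b t /\<^sub>R t)) = (a t - x) /\<^sub>R t"
    using ev eq
  proof eventually_elim
    case (elim t)
    have "(\<Sum>b\<in>B. r b (a t) *\<^sub>R (d b t /\<^sub>R t)) = (\<Sum>b\<in>B. r b (a t) *\<^sub>R d b t) /\<^sub>R t"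
      by (simp add: scaleR_sum_right mult.commute)
    also have "(\<Sum>b\<in>B. r b (a t) *\<^sub>R d b t) = l t - a t"
      using elim(1)[rule_format, of "a t"] elim(2) by simp
    finally show ?case
      by (simp flip: scaleR_diff_right)
  qed
  ultimately have 1: "((\<lambda>t. (a t - x) /\<^sub>R t) \<longlongrightarrow> l' - (\<Sum>b\<in>B. r b x *\<^sub>R R' b)) (at 0)"
    by (rule Lim_transform_eventually)
  have "((\<lambda>t. \<Sum>b\<in>B. r b x *\<^sub>R (d b t /\<^sub>R t)) \<longlongrightarrow> (\<Sum>b\<in>B. r b x *\<^sub>R R' b)) (at 0)"
    by (intro tendsto_intros dlim)
  moreover have "\<forall>\<^sub>F t in at 0. (\<Sum>b\<in>B. r b x *\<^sub>R (d b t /\<^sub>R t)) = d x t /\<^sub>R t"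
    using ev
  proof eventually_elim
    case (elim t)
    then have "d x t = (\<Sum>b\<in>B. r b x *\<^sub>R d b t)"
      by (simp only: d_def[of x])
    then show ?case
      by (simp add: scaleR_sum_right mult.commute)
  qed
  ultimately have "((\<lambda>t. d x t /\<^sub>R t) \<longlongrightarrow> (\<Sum>b\<in>B. r b x *\<^sub>R R' b)) (at 0)"
    by (rule Lim_transform_eventually)
  then have "(\<Sum>b\<in>B. r b x *\<^sub>R R' b) = R' x"
    using dlim[of x] by (rule tendsto_unique[rotated]) simp
  with 1 show ?thesis
    by (simp add: has_vector_derivative_iff_quotient_tendsto a0)
qed

lemma has_real_derivative_bilinear:
  fixes ip :: "'a::real_normed_vector \<Rightarrow> 'a \<Rightarrow> real"
  assumes "finite B0" and "span B0 = (UNIV :: 'a set)" and bil: "bilinear ip"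
    and a: "(a has_vector_derivative a') (at t)" and b: "(b has_vector_derivative b') (at t)"
  shows "((\<lambda>t. ip (a t) (b t)) has_real_derivative (ip a' (b t) + ip (a t) b')) (at t)"
proof -
  obtain B and r :: "'a \<Rightarrow> 'a \<Rightarrow> real"
    where fin: "finite B" and r: "\<And>b. bounded_linear (r b)" and rs: "\<And>v. (\<Sum>b\<in>B. r b v *\<^sub>R b) = v"
    using finite_span_bounded_coordinates[OF assms(1,2)] by blast
  have lin1: "linear (\<lambda>u. ip u w)" and lin2: "linear (ip u)" for u w
    using bil by (auto simp: bilinear_def)
  have exp1: "ip u w = (\<Sum>c\<in>B. r c u * ip c w)" for u w
    using linear_sum_coordinates[where r=r, OF lin1[of w] rs[of u]] by simp
  have exp2: "ip u w = (\<Sum>c\<in>B. r c w * ip u c)" for u w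
    using linear_sum_coordinates[where r=r, OF lin2[of u] rs[of w]] by simp
  have bl: "bounded_linear (ip u)" for u
  proof -
    have eq: "ip u = (\<lambda>w. \<Sum>c\<in>B. r c w * ip u c)"
      by (rule ext) (rule exp2)
    show ?thesis
      by (subst eq) (intro bounded_linear_sum bounded_linear_mult_const r)
  qed
  have da: "((\<lambda>t. r c (a t)) has_real_derivative r c a') (at t)" for c
    using bounded_linear.has_vector_derivative[OF r a]
    by (simp add: has_real_derivative_iff_has_vector_derivative)
  have db: "((\<lambda>t. ip c (b t)) has_real_derivative ip c b') (at t)" for c
    using bounded_linear.has_vector_derivative[OF bl b]
    by (simp add: has_real_derivative_iff_has_vector_derivative)
  have "((\<lambda>t. \<Sum>c\<in>B. r c (a t) * ip c (b t)) has_real_derivative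
      (\<Sum>c\<in>B. r c a' * ip c (b t) + r c (a t) * ip c b')) (at t)"
    by (intro DERIV_sum) (use DERIV_mult'[OF da db] in \<open>simp add: add.commute\<close>)
  then show ?thesis
    by (simp add: sum.distrib flip: exp1)
qed

lemma mean_value_deviation_bound:
  fixes g :: "real \<Rightarrow> 'b::real_normed_vector"
  assumes "h \<ge> 0" and g: "\<And>t. t \<in> {0..h} \<Longrightarrow> (g has_vector_derivative g' t) (at t)"
    and bd: "\<And>t. t \<in> {0..h} \<Longrightarrow> norm (g' t - c) \<le> e"
  shows "norm (g h - g 0 - h *\<^sub>R c) \<le> h * e"
proof -
  let ?k = "\<lambda>t. g t - t *\<^sub>R c"
  have "norm (?k h - ?k 0) \<le> e * norm (h - 0)"
  proof (rule differentiable_bound[where S="{0..h}"])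
    fix t assume t: "t \<in> {0..h}"
    have "(?k has_vector_derivative (g' t - c)) (at t)"
      by (rule derivative_eq_intros g[OF t] refl)+ simp
    then show "(?k has_derivative (\<lambda>s. s *\<^sub>R (g' t - c))) (at t within {0..h})"
      using has_derivative_at_withinI has_vector_derivative_def by blast
    show "onorm (\<lambda>s. s *\<^sub>R (g' t - c)) \<le> e"
      using bd[OF t] by (intro onorm_le) (auto simp: mult.commute[of e] mult_left_mono)
  qed (use \<open>h \<ge> 0\<close> in auto)
  then show ?thesis
    using \<open>h \<ge> 0\<close> by (simp add: algebra_simps)
qed

text \<open>The second difference of $f$ over the parallelogram with sides $hu$ and $hv$ is $h^2 c$ up to an
  error $h^2 e$ as soon as the mixed derivative $D_v D_u f$ stays within $e$ of $c$: apply the mean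
  value inequality first to the difference in direction $u$ and then to $D_u f$ in direction $v$.\<close>
lemma mixed_difference_estimate:
  fixes f :: "'v::real_normed_vector \<Rightarrow> 'b::real_normed_vector"
  assumes "h \<ge> 0"
    and mem: "\<And>s t. s \<in> {0..h} \<Longrightarrow> t \<in> {0..h} \<Longrightarrow> P + s *\<^sub>R u + t *\<^sub>R v \<in> U"
    and f: "\<And>z. z \<in> U \<Longrightarrow> (f has_derivative f' z) (at z)"
    and fu: "\<And>z. z \<in> U \<Longrightarrow> ((\<lambda>z. f' z u) has_derivative fu' z) (at z)"
    and bd: "\<And>z. z \<in> U \<Longrightarrow> norm (fu' z v - c) \<le> e"
  shows "norm (f (P + h *\<^sub>R u + h *\<^sub>R v) - f (P + h *\<^sub>R u) - f (P + h *\<^sub>R v) + f P - (h * h) *\<^sub>R c)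
         \<le> h * h * e"
proof -
  let ?z = "\<lambda>s t. P + s *\<^sub>R u + t *\<^sub>R v"
  have along_u: "((\<lambda>s. f (?z s t)) has_vector_derivative f' (?z s t) u) (at s)"
    if "s \<in> {0..h}" "t \<in> {0..h}" for s t
  proof -
    have "((\<lambda>s. ?z s t) has_derivative (\<lambda>s. s *\<^sub>R u)) (at s)"
      by (rule derivative_eq_intros refl)+ simp
    from has_derivative_compose[OF this f[OF mem[OF that]]] show ?thesis
      using has_derivative_linear[OF f[OF mem[OF that]]]
      by (simp add: has_vector_derivative_def linear_scale)
  qed
  have along_v: "((\<lambda>t. f' (?z s t) u) has_vector_derivative fu' (?z s t) v) (at t)"
    if "s \<in> {0..h}" "t \<in> {0..h}" for s t
  proof -
    have "((\<lambda>t. ?z s t) has_derivative (\<lambda>t. t *\<^sub>R v)) (at t)"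
      by (rule derivative_eq_intros refl)+ simp
    from has_derivative_compose[OF this fu[OF mem[OF that]]] show ?thesis
      using has_derivative_linear[OF fu[OF mem[OF that]]]
      by (simp add: has_vector_derivative_def linear_scale)
  qed
  have "norm (f' (?z s h) u - f' (?z s 0) u - h *\<^sub>R c) \<le> h * e" if "s \<in> {0..h}" for s
    by (rule mean_value_deviation_bound[OF \<open>h \<ge> 0\<close> along_v]) (use that mem bd in auto)
  then have "norm ((f (?z h h) - f (?z h 0)) - (f (?z 0 h) - f (?z 0 0)) - h *\<^sub>R (h *\<^sub>R c)) \<le> h * (h * e)"
    using \<open>h \<ge> 0\<close>
    by (intro mean_value_deviation_bound[where g = "\<lambda>s. f (?z s h) - f (?z s 0)" and g' = "\<lambda>s. f' (?z s h) u - f' (?z s 0) u"]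
        has_vector_derivative_diff along_u) simp_all
  then show ?thesis
    by (simp add: algebra_simps)
qed

text \<open>Schwarz's theorem. The second difference is symmetric in $u$ and $v$, so the preceding estimate
  compares both mixed derivatives with the same quantity.\<close>
lemma mixed_derivatives_commute:
  fixes f :: "'v::real_normed_vector \<Rightarrow> 'b::real_normed_vector"
  assumes "open S" "P \<in> S"
    and f: "\<And>z. z \<in> S \<Longrightarrow> (f has_derivative f' z) (at z)"
    and fu: "\<And>z. z \<in> S \<Longrightarrow> ((\<lambda>z. f' z u) has_derivative fu' z) (at z)"
    and fv: "\<And>z. z \<in> S \<Longrightarrow> ((\<lambda>z. f' z v) has_derivative fv' z) (at z)"
    and cu: "isCont (\<lambda>z. fu' z v) P" and cv: "isCont (\<lambda>z. fv' z u) P"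
  shows "fu' P v = fv' P u"
proof -
  have "norm (fu' P v - fv' P u) \<le> e" if "e > 0" for e
  proof -
    have "\<forall>\<^sub>F z in nhds P. z \<in> S \<and> dist (fu' z v) (fu' P v) < e/2 \<and> dist (fv' z u) (fv' P u) < e/2"
      using assms(1,2) cu cv \<open>e > 0\<close>
      by (intro eventually_conj eventually_nhds_in_open tendstoD)
         (auto simp: isCont_def tendsto_nhds_iff)
    then obtain d where d: "d > 0" and close: "\<And>z. dist z P < d \<Longrightarrow>
        z \<in> S \<and> dist (fu' z v) (fu' P v) < e/2 \<and> dist (fv' z u) (fv' P u) < e/2"
      by (auto simp: eventually_nhds_metric)
    \<comment> \<open>The side length is chosen such that the parallelogram lies in the ball of radius \<open>d\<close>.\<close>
    define h where "h = d / (2 * (norm u + norm v + 1))"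
    have h: "h > 0"
      using d by (simp add: h_def add_nonneg_pos)
    have mem: "P + s *\<^sub>R u + t *\<^sub>R v \<in> ball P d" if "s \<in> {0..h}" "t \<in> {0..h}" for s t
    proof -
      have dist_add: "dist P (P + w) = norm w" for w
        by (simp add: dist_norm)
      have "norm (s *\<^sub>R u + t *\<^sub>R v) \<le> h * norm u + h * norm v"
        using that by (intro norm_triangle_le add_mono) (auto simp: mult_right_mono)
      also have "\<dots> \<le> h * (norm u + norm v + 1)"
        using h by (simp add: algebra_simps)
      also have "\<dots> = d / 2"
      proof -
        have "norm u + norm v + 1 > 0" by (simp add: add_nonneg_pos)
        then show ?thesis by (simp add: h_def field_simps)
      qed
      also have "\<dots> < d" using d by simp
      finally show ?thesis
        using dist_add[of "s *\<^sub>R u + t *\<^sub>R v"] by (simp add: add.assoc)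
    qed
    let ?\<Delta> = "f (P + h *\<^sub>R u + h *\<^sub>R v) - f (P + h *\<^sub>R u) - f (P + h *\<^sub>R v) + f P"
    have inS: "z \<in> S" and fu_close: "norm (fu' z v - fu' P v) \<le> e/2"
      and fv_close: "norm (fv' z u - fv' P u) \<le> e/2" if "z \<in> ball P d" for z
      using close[of z] that by (auto simp: dist_commute[of P] simp flip: dist_norm)
    have 1: "norm (?\<Delta> - (h * h) *\<^sub>R fu' P v) \<le> h * h * (e/2)"
      by (rule mixed_difference_estimate[where U="ball P d" and f'=f' and fu'=fu'])
         (rule less_imp_le[OF h] mem f fu fu_close inS | assumption)+
    have mem': "P + s *\<^sub>R v + t *\<^sub>R u \<in> ball P d" if "s \<in> {0..h}" "t \<in> {0..h}" for s t
      using mem[OF that(2,1)] by (simp add: algebra_simps)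
    have "norm (f (P + h *\<^sub>R v + h *\<^sub>R u) - f (P + h *\<^sub>R v) - f (P + h *\<^sub>R u) + f P - (h * h) *\<^sub>R fv' P u) \<le> h * h * (e/2)"
      by (rule mixed_difference_estimate[where U="ball P d" and f'=f' and fu'=fv'])
         (rule less_imp_le[OF h] mem' f fv fv_close inS | assumption)+
    then have 2: "norm (?\<Delta> - (h * h) *\<^sub>R fv' P u) \<le> h * h * (e/2)"
      by (simp add: algebra_simps)
    have "(h * h) *\<^sub>R (fu' P v - fv' P u) = (?\<Delta> - (h * h) *\<^sub>R fv' P u) - (?\<Delta> - (h * h) *\<^sub>R fu' P v)"
      by (simp add: algebra_simps)
    then have "norm ((h * h) *\<^sub>R (fu' P v - fv' P u)) \<le> h * h * (e/2) + h * h * (e/2)"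
      by (simp only: order_trans[OF norm_triangle_ineq4 add_mono[OF 2 1]])
    then have "(h * h) * norm (fu' P v - fv' P u) \<le> (h * h) * e"
      by (simp add: mult.commute)
    then show ?thesis using h by simp
  qed
  then have "norm (fu' P v - fv' P u) \<le> 0"
    by (rule field_le_epsilon[of _ 0, simplified])
  then show ?thesis by simp
qed


section \<open>Derivatives of maps in charts\<close>

lemma smooth_on_imp_continuous_on: "smooth_on S f \<Longrightarrow> continuous_on S f"
  unfolding smooth_on_def by (metis times_differentiable_on.simps(1))

lemma smooth_on_has_derivative:
  assumes "smooth_on S f" "x \<in> S"
  shows "(f has_derivative frechet_derivative f (at x)) (at x)"
proof -
  have "times_differentiable_on (Suc 0) S f"
    using assms(1) unfolding smooth_on_def by blast
  then show ?thesis
    using assms(2) frechet_derivative_works by auto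
qed

lemma smooth_on_directional_derivative:
  assumes "smooth_on S f"
  shows "smooth_on S (\<lambda>x. frechet_derivative f (at x) v)"
  unfolding smooth_on_def
proof
  fix n
  have "times_differentiable_on (Suc n) S f"
    using assms unfolding smooth_on_def by blast
  then show "times_differentiable_on n S (\<lambda>x. frechet_derivative f (at x) v)"
    by simp
qed

text \<open>The condition that an atlas imposes on each single chart, isolated so that it can be shared by the
  product charts in which the multiplication is differentiated.\<close>
definition valid_chart :: "('m::topological_space, 'e::real_normed_vector) chart \<Rightarrow> bool"
  where "valid_chart c \<longleftrightarrow> open (fst c) \<and> open (snd c ` fst c) \<and>
     homeomorphism (fst c) (snd c ` fst c) (snd c) (chart_inv c)"

lemma valid_chart_inverse:
  assumes "valid_chart c"
  shows "p \<in> fst c \<Longrightarrow> chart_inv c (snd c p) = p"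
    and "\<xi> \<in> snd c ` fst c \<Longrightarrow> snd c (chart_inv c \<xi>) = \<xi>"
    and "\<xi> \<in> snd c ` fst c \<Longrightarrow> chart_inv c \<xi> \<in> fst c"
  using assms by (auto simp: valid_chart_def homeomorphism_def)

lemma valid_chart_isCont_inverse:
  assumes "valid_chart c" "p \<in> fst c"
  shows "isCont (chart_inv c) (snd c p)"
  using assms unfolding valid_chart_def homeomorphism_def
  by (auto simp: continuous_on_eq_continuous_at)

lemma valid_chart_open_image:
  assumes "valid_chart c" "open U"
  shows "open (snd c ` (fst c \<inter> U))"
proof -
  have "snd c ` (fst c \<inter> U) = snd c ` fst c \<inter> chart_inv c -` U"
    using valid_chart_inverse[OF assms(1)] by (auto simp: image_iff)
  moreover have "continuous_on (snd c ` fst c) (chart_inv c)" "open (snd c ` fst c)"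
    using assms(1) by (auto simp: valid_chart_def homeomorphism_def)
  ultimately show ?thesis
    using assms(2) by (simp add: continuous_on_open_vimage Int_commute)
qed

lemma smooth_manifold_charts:
  assumes "smooth_manifold A"
  shows "c \<in> A \<Longrightarrow> valid_chart c" and "chart_at A p \<in> A" and "p \<in> fst (chart_at A p)"
proof -
  show "valid_chart c" if "c \<in> A"
    using assms that unfolding smooth_manifold_def valid_chart_def by blast
  have "\<exists>c. c \<in> A \<and> p \<in> fst c"
    using assms unfolding smooth_manifold_def by blast
  then have "chart_at A p \<in> A \<and> p \<in> fst (chart_at A p)"
    unfolding chart_at_def by (rule someI_ex)
  then show "chart_at A p \<in> A" and "p \<in> fst (chart_at A p)" by auto
qed

definition prod_chart :: "('m, 'e) chart \<Rightarrow> ('n, 'f) chart \<Rightarrow> ('m \<times> 'n, 'e \<times> 'f) chart"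
  where "prod_chart c d = (fst c \<times> fst d, map_prod (snd c) (snd d))"

lemma fst_prod_chart [simp]: "fst (prod_chart c d) = fst c \<times> fst d"
  and snd_prod_chart [simp]: "snd (prod_chart c d) = map_prod (snd c) (snd d)"
  by (simp_all add: prod_chart_def)

lemma prod_chart_in_prod_atlas: "c \<in> A \<Longrightarrow> d \<in> B \<Longrightarrow> prod_chart c d \<in> prod_atlas A B"
  unfolding prod_chart_def prod_atlas_def by blast

lemma valid_prod_chart:
  assumes c: "valid_chart c" and d: "valid_chart d"
  shows "valid_chart (prod_chart c d)"
proof -
  let ?I = "snd c ` fst c \<times> snd d ` fst d"
  have im: "map_prod (snd c) (snd d) ` (fst c \<times> fst d) = ?I"
    by (auto simp: map_prod_def image_iff)
  have inj: "inj_on (map_prod (snd c) (snd d)) (fst c \<times> fst d)"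
    using valid_chart_inverse(1)[OF c] valid_chart_inverse(1)[OF d] by (intro map_prod_inj_on) (metis inj_on_def)+
  have inv: "chart_inv (prod_chart c d) \<zeta> = (chart_inv c (fst \<zeta>), chart_inv d (snd \<zeta>))" if "\<zeta> \<in> ?I" for \<zeta>
    unfolding chart_inv_def[of "prod_chart c d"]
    by (rule inv_into_f_eq)
       (use that inj valid_chart_inverse[OF c] valid_chart_inverse[OF d] in auto)
  have cont: "continuous_on (fst c) (snd c)" "continuous_on (snd c ` fst c) (chart_inv c)"
    "continuous_on (fst d) (snd d)" "continuous_on (snd d ` fst d) (chart_inv d)"
    using c d by (auto simp: valid_chart_def homeomorphism_def)
  have "continuous_on ?I (\<lambda>\<zeta>. (chart_inv c (fst \<zeta>), chart_inv d (snd \<zeta>)))"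
    by (intro continuous_intros continuous_on_compose2[OF cont(2)] continuous_on_compose2[OF cont(4)]) auto
  then have "continuous_on ?I (chart_inv (prod_chart c d))"
    using inv by (simp cong: continuous_on_cong)
  moreover have "continuous_on (fst c \<times> fst d) (map_prod (snd c) (snd d))"
    unfolding map_prod_def case_prod_unfold
    by (intro continuous_intros continuous_on_compose2[OF cont(1)] continuous_on_compose2[OF cont(3)]) auto
  ultimately have "homeomorphism (fst c \<times> fst d) ?I (map_prod (snd c) (snd d)) (chart_inv (prod_chart c d))"
    using valid_chart_inverse[OF c] valid_chart_inverse[OF d] inv
    by (intro homeomorphismI) auto
  then show ?thesis
    using c d by (simp add: valid_chart_def im open_Times)
qed

text \<open>The tangent map \<^const>\<open>mderiv\<close> is tied to the preferred charts of the two points, which differ from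
  point to point. The following relation allows arbitrary charts and includes continuity at $p$, so
  that it obeys a chain rule through any intermediate chart. A change of charts is then just the
  derivative of the identity map between two charts, and tangent maps are identified by
  uniqueness.\<close>
definition has_chart_derivative ::
  "('m::t2_space, 'e::real_normed_vector) chart \<Rightarrow>
   ('n::topological_space, 'f::real_normed_vector) chart \<Rightarrow>
   ('m \<Rightarrow> 'n) \<Rightarrow> 'm \<Rightarrow> ('e \<Rightarrow> 'f) \<Rightarrow> bool"
where
  "has_chart_derivative c d F p F' \<longleftrightarrow> p \<in> fst c \<and> F p \<in> fst d \<and> isCont F p \<and>
     ((snd d \<circ> F \<circ> chart_inv c) has_derivative F') (at (snd c p))"

lemma has_chart_derivative_chain:
  assumes c: "valid_chart c" and d: "valid_chart d"
    and F: "has_chart_derivative c d F p F'" and H: "has_chart_derivative d e H (F p) H'"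
  shows "has_chart_derivative c e (\<lambda>x. H (F x)) p (H' \<circ> F')"
proof -
  have p: "p \<in> fst c" "F p \<in> fst d" "isCont F p" "isCont H (F p)" "H (F p) \<in> fst e"
    using F H by (auto simp: has_chart_derivative_def)
  have inv: "chart_inv c (snd c p) = p" "chart_inv d (snd d (F p)) = F p"
    using valid_chart_inverse(1)[OF c p(1)] valid_chart_inverse(1)[OF d p(2)] by auto
  have "isCont (\<lambda>\<xi>. F (chart_inv c \<xi>)) (snd c p)"
    by (rule isCont_o2[OF valid_chart_isCont_inverse[OF c p(1)]]) (simp add: inv p)
  then have "\<forall>\<^sub>F \<xi> in at (snd c p). F (chart_inv c \<xi>) \<in> fst d"
    using d p(2) inv unfolding isCont_def valid_chart_def by (auto dest: topological_tendstoD)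
  then have ev: "\<forall>\<^sub>F \<xi> in at (snd c p).
     ((snd e \<circ> H \<circ> chart_inv d) \<circ> (snd d \<circ> F \<circ> chart_inv c)) \<xi> = (snd e \<circ> (\<lambda>x. H (F x)) \<circ> chart_inv c) \<xi>"
    by eventually_elim (simp add: valid_chart_inverse(1)[OF d])
  have "((snd e \<circ> H \<circ> chart_inv d) \<circ> (snd d \<circ> F \<circ> chart_inv c) has_derivative H' \<circ> F') (at (snd c p))"
    using F H by (intro diff_chain_at) (auto simp: has_chart_derivative_def inv)
  then have "((snd e \<circ> (\<lambda>x. H (F x)) \<circ> chart_inv c) has_derivative H' \<circ> F') (at (snd c p))"
    by (rule has_derivative_transform_eventually[OF _ ev]) (auto simp: inv)
  moreover have "isCont (\<lambda>x. H (F x)) p"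
    by (rule isCont_o2[OF p(3,4)])
  ultimately show ?thesis
    using p by (simp add: has_chart_derivative_def)
qed

lemma has_chart_derivative_unique:
  assumes "has_chart_derivative c d F p F1" "has_chart_derivative c d F p F2"
  shows "F1 = F2"
  using assms has_derivative_unique unfolding has_chart_derivative_def by blast

lemma has_chart_derivative_linear:
  "has_chart_derivative c d F p F' \<Longrightarrow> linear F'"
  unfolding has_chart_derivative_def using has_derivative_linear by blast

lemma has_chart_derivative_ident:
  assumes c: "valid_chart c" and p: "p \<in> fst c"
  shows "has_chart_derivative c c (\<lambda>x. x) p (\<lambda>v. v)"
proof -
  \<comment> \<open>Off the image of the chart, \<open>chart_inv c\<close> takes arbitrary values, so the representative is the
    identity only near \<open>snd c p\<close>.\<close>
  have "\<forall>\<^sub>F \<xi> in nhds (snd c p). \<xi> \<in> snd c ` fst c"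
    using c p by (intro eventually_nhds_in_open) (auto simp: valid_chart_def)
  then have "\<forall>\<^sub>F \<xi> in at (snd c p). \<xi> \<in> snd c ` fst c"
    by (rule filter_leD[OF at_within_le_nhds])
  then have ev: "\<forall>\<^sub>F \<xi> in at (snd c p). \<xi> = (snd c \<circ> (\<lambda>x. x) \<circ> chart_inv c) \<xi>"
    by eventually_elim (simp add: valid_chart_inverse[OF c])
  have "((snd c \<circ> (\<lambda>x. x) \<circ> chart_inv c) has_derivative (\<lambda>v. v)) (at (snd c p))"
    by (rule has_derivative_transform_eventually[OF has_derivative_ident ev])
       (auto simp: valid_chart_inverse[OF c] p)
  then show ?thesis
    using p by (simp add: has_chart_derivative_def)
qed

lemma has_chart_derivative_const:
  "p \<in> fst c \<Longrightarrow> q \<in> fst d \<Longrightarrow> has_chart_derivative c d (\<lambda>_. q) p (\<lambda>_. 0)"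
  by (simp add: has_chart_derivative_def o_def)

lemma has_chart_derivative_Pair:
  assumes "has_chart_derivative c d F p F'" "has_chart_derivative c d' H p H'"
  shows "has_chart_derivative c (prod_chart d d') (\<lambda>x. (F x, H x)) p (\<lambda>v. (F' v, H' v))"
  using assms
  by (auto simp: has_chart_derivative_def o_def intro!: has_derivative_Pair isCont_Pair)

lemma smooth_map_has_chart_derivative:
  assumes "smooth_map A B F" "c \<in> A" "d \<in> B" "p \<in> fst c" "F p \<in> fst d"
  shows "has_chart_derivative c d F p (frechet_derivative (snd d \<circ> F \<circ> chart_inv c) (at (snd c p)))"
proof -
  have "smooth_on (snd c ` (fst c \<inter> F -` fst d)) (snd d \<circ> F \<circ> chart_inv c)" "continuous_on UNIV F"
    using assms unfolding smooth_map_def by blast+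
  then show ?thesis
    using assms smooth_on_has_derivative
    by (fastforce simp: has_chart_derivative_def continuous_on_eq_continuous_at)
qed

lemma transition_has_chart_derivative:
  assumes "smooth_manifold A" "c \<in> A" "d \<in> A" "p \<in> fst c" "p \<in> fst d"
  shows "has_chart_derivative c d (\<lambda>x. x) p (frechet_derivative (snd d \<circ> chart_inv c) (at (snd c p)))"
proof -
  have "smooth_on (snd c ` (fst c \<inter> fst d)) (snd d \<circ> chart_inv c)"
    using assms unfolding smooth_manifold_def by blast
  then have "((snd d \<circ> chart_inv c) has_derivative frechet_derivative (snd d \<circ> chart_inv c) (at (snd c p))) (at (snd c p))"
    by (rule smooth_on_has_derivative) (use assms in auto)
  then show ?thesis
    using assms by (simp add: has_chart_derivative_def o_def)
qed

lemma mderiv_eqI: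
  assumes "has_chart_derivative (chart_at A p) (chart_at B (F p)) F p F'"
  shows "mderiv A B F p = F'"
  using assms frechet_derivative_at unfolding has_chart_derivative_def mderiv_def by metis

lemma has_chart_derivative_mderiv:
  assumes "has_chart_derivative (chart_at A p) (chart_at B (F p)) F p F'"
  shows "has_chart_derivative (chart_at A p) (chart_at B (F p)) F p (mderiv A B F p)"
  using assms mderiv_eqI by metis


section \<open>Translations of a Lie group and the Maurer--Cartan form\<close>

abbreviation mult_map :: "'g monoid \<Rightarrow> 'g \<times> 'g \<Rightarrow> 'g"
  where "mult_map G \<equiv> \<lambda>(g, h). g \<otimes>\<^bsub>G\<^esub> h"

lemma lie_groupD:
  assumes "lie_group G A"
  shows "group G" "carrier G = UNIV" "smooth_manifold A" "smooth_map (prod_atlas A A) A (mult_map G)"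
  using assms unfolding lie_group_def by auto

lemma lie_group_cancel:
  assumes "lie_group G A"
  shows "\<one>\<^bsub>G\<^esub> \<otimes>\<^bsub>G\<^esub> g = g" "g \<otimes>\<^bsub>G\<^esub> \<one>\<^bsub>G\<^esub> = g"
    "g \<otimes>\<^bsub>G\<^esub> (inv\<^bsub>G\<^esub> g \<otimes>\<^bsub>G\<^esub> h) = h" "inv\<^bsub>G\<^esub> g \<otimes>\<^bsub>G\<^esub> (g \<otimes>\<^bsub>G\<^esub> h) = h"
    "g \<otimes>\<^bsub>G\<^esub> inv\<^bsub>G\<^esub> g = \<one>\<^bsub>G\<^esub>" "inv\<^bsub>G\<^esub> g \<otimes>\<^bsub>G\<^esub> g = \<one>\<^bsub>G\<^esub>"
    "(h \<otimes>\<^bsub>G\<^esub> inv\<^bsub>G\<^esub> g) \<otimes>\<^bsub>G\<^esub> g = h"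
proof -
  interpret group G using lie_groupD[OF assms] by simp
  have [simp]: "x \<in> carrier G" for x using lie_groupD[OF assms] by simp
  show "\<one>\<^bsub>G\<^esub> \<otimes>\<^bsub>G\<^esub> g = g" "g \<otimes>\<^bsub>G\<^esub> \<one>\<^bsub>G\<^esub> = g"
    "g \<otimes>\<^bsub>G\<^esub> (inv\<^bsub>G\<^esub> g \<otimes>\<^bsub>G\<^esub> h) = h" "inv\<^bsub>G\<^esub> g \<otimes>\<^bsub>G\<^esub> (g \<otimes>\<^bsub>G\<^esub> h) = h"
    "g \<otimes>\<^bsub>G\<^esub> inv\<^bsub>G\<^esub> g = \<one>\<^bsub>G\<^esub>" "inv\<^bsub>G\<^esub> g \<otimes>\<^bsub>G\<^esub> g = \<one>\<^bsub>G\<^esub>"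
    by (simp_all flip: m_assoc)
  show "(h \<otimes>\<^bsub>G\<^esub> inv\<^bsub>G\<^esub> g) \<otimes>\<^bsub>G\<^esub> g = h"
    by (simp add: m_assoc)
qed

lemma mult_has_chart_derivative:
  assumes G: "lie_group G A" and c: "c \<in> A" "c' \<in> A" "d \<in> A" and p: "g \<in> fst c" "h \<in> fst c'" "g \<otimes>\<^bsub>G\<^esub> h \<in> fst d"
  shows "has_chart_derivative (prod_chart c c') d (mult_map G) (g, h)
     (frechet_derivative (snd d \<circ> mult_map G \<circ> chart_inv (prod_chart c c')) (at (snd c g, snd c' h)))"
  using smooth_map_has_chart_derivative[OF lie_groupD(4)[OF G] prod_chart_in_prod_atlas[OF c(1,2)] c(3), of "(g, h)"] p
  by simp

text \<open>Both translations are compositions of the multiplication with a map $h\mapsto(g,h)$ or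
  $h\mapsto(h,g)$, so the chain rule reduces them to the smoothness of the multiplication.\<close>
lemma translations_have_chart_derivative:
  assumes G: "lie_group G A" and c: "c \<in> A" "d \<in> A" and h: "h \<in> fst c"
  shows "g \<otimes>\<^bsub>G\<^esub> h \<in> fst d \<Longrightarrow> \<exists>D. has_chart_derivative c d (\<lambda>h. g \<otimes>\<^bsub>G\<^esub> h) h D"
    and "h \<otimes>\<^bsub>G\<^esub> g \<in> fst d \<Longrightarrow> \<exists>D. has_chart_derivative c d (\<lambda>h. h \<otimes>\<^bsub>G\<^esub> g) h D"
proof -
  let ?c' = "chart_at A g"
  note M = lie_groupD(3)[OF G]
  note vc = smooth_manifold_charts(1)[OF M]
  have c': "?c' \<in> A" "g \<in> fst ?c'" using smooth_manifold_charts(2,3)[OF M] by auto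
  have id: "has_chart_derivative c c (\<lambda>x. x) h (\<lambda>v. v)" and const: "has_chart_derivative c ?c' (\<lambda>_. g) h (\<lambda>_. 0)"
    using has_chart_derivative_ident[OF vc[OF c(1)] h] has_chart_derivative_const[OF h c'(2)] by auto
  show "\<exists>D. has_chart_derivative c d (\<lambda>h. g \<otimes>\<^bsub>G\<^esub> h) h D" if "g \<otimes>\<^bsub>G\<^esub> h \<in> fst d"
    using has_chart_derivative_chain[OF vc[OF c(1)] valid_prod_chart[OF vc[OF c'(1)] vc[OF c(1)]]
        has_chart_derivative_Pair[OF const id] mult_has_chart_derivative[OF G c'(1) c(1,2) c'(2) h that]] by auto
  show "\<exists>D. has_chart_derivative c d (\<lambda>h. h \<otimes>\<^bsub>G\<^esub> g) h D" if "h \<otimes>\<^bsub>G\<^esub> g \<in> fst d"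
    using has_chart_derivative_chain[OF vc[OF c(1)] valid_prod_chart[OF vc[OF c(1)] vc[OF c'(1)]]
        has_chart_derivative_Pair[OF id const] mult_has_chart_derivative[OF G c(1) c'(1) c(2) h c'(2) that]] by auto
qed

text \<open>The left Maurer--Cartan form is the tangent map of the translation by $g^{-1}$; the tangent map of
  the translation by $g$ inverts it.\<close>
lemma theta_L_bijective:
  assumes G: "lie_group G A"
  shows "linear (theta_L G A g)" "bij (theta_L G A g)"
proof -
  note M = lie_groupD(3)[OF G]
  note ch = smooth_manifold_charts[OF M]
  note cancel = lie_group_cancel[OF G]
  let ?c = "chart_at A g" and ?e = "chart_at A \<one>\<^bsub>G\<^esub>"
  obtain T where T: "has_chart_derivative ?c ?e (\<lambda>h. inv\<^bsub>G\<^esub> g \<otimes>\<^bsub>G\<^esub> h) g T"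
    using translations_have_chart_derivative(1)[OF G ch(2,2,3)] ch(3) cancel by metis
  obtain S where S: "has_chart_derivative ?e ?c (\<lambda>h. g \<otimes>\<^bsub>G\<^esub> h) \<one>\<^bsub>G\<^esub> S"
    using translations_have_chart_derivative(1)[OF G ch(2,2,3)] ch(3) cancel by metis
  have "theta_L G A g = T"
    unfolding theta_L_def by (rule mderiv_eqI) (use T cancel in simp)
  moreover have "has_chart_derivative ?c ?c (\<lambda>h. h) g (S \<circ> T)"
    using has_chart_derivative_chain[OF ch(1)[OF ch(2)] ch(1)[OF ch(2)] T, of ?c "\<lambda>h. g \<otimes>\<^bsub>G\<^esub> h" S] S cancel by simp
  then have "S \<circ> T = (\<lambda>v. v)"
    by (rule has_chart_derivative_unique) (rule has_chart_derivative_ident[OF ch(1)[OF ch(2)] ch(3)])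
  moreover have "has_chart_derivative ?e ?e (\<lambda>h. h) \<one>\<^bsub>G\<^esub> (T \<circ> S)"
    using has_chart_derivative_chain[OF ch(1)[OF ch(2)] ch(1)[OF ch(2)] S, of ?e "\<lambda>h. inv\<^bsub>G\<^esub> g \<otimes>\<^bsub>G\<^esub> h" T] T cancel by simp
  then have "T \<circ> S = (\<lambda>v. v)"
    by (rule has_chart_derivative_unique) (rule has_chart_derivative_ident[OF ch(1)[OF ch(2)] ch(3)])
  ultimately show "linear (theta_L G A g)" "bij (theta_L G A g)"
    using has_chart_derivative_linear[OF T] o_bij[of S T] by (auto simp: id_def)
qed

section \<open>The bracket as the antisymmetrized second derivative of the multiplication\<close>

definition unit_chart :: "'g monoid \<Rightarrow> ('g, 'a) chart set \<Rightarrow> ('g, 'a) chart"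
  where "unit_chart G A = chart_at A \<one>\<^bsub>G\<^esub>"

definition unit_coord :: "'g monoid \<Rightarrow> ('g, 'a) chart set \<Rightarrow> 'a"
  where "unit_coord G A = snd (unit_chart G A) \<one>\<^bsub>G\<^esub>"

text \<open>The multiplication in coordinates, $m(\xi,\eta)$. It is meaningful where both factors and their
  product lie in the chart around the unit.\<close>
definition mult_rep :: "'g monoid \<Rightarrow> ('g, 'a) chart set \<Rightarrow> 'a \<times> 'a \<Rightarrow> 'a"
  where "mult_rep G A = snd (unit_chart G A) \<circ> mult_map G \<circ> chart_inv (prod_chart (unit_chart G A) (unit_chart G A))"

definition mult_domain :: "'g monoid \<Rightarrow> ('g, 'a) chart set \<Rightarrow> ('a \<times> 'a) set"
  where "mult_domain G A = (let c = unit_chart G A in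
     snd (prod_chart c c) ` (fst (prod_chart c c) \<inter> mult_map G -` fst c))"

definition mult_deriv :: "'g monoid \<Rightarrow> ('g, 'a::real_normed_vector) chart set \<Rightarrow> 'a \<times> 'a \<Rightarrow> 'a \<times> 'a \<Rightarrow> 'a"
  where "mult_deriv G A \<zeta> = frechet_derivative (mult_rep G A) (at \<zeta>)"

text \<open>With $e$ the coordinate of the unit, this is the mixed second derivative $H(x,y) = D_{(x,0)}D_{(0,y)}m(e,e)$,
  the mixed second-order term in the Taylor expansion of the multiplication. Both the Lie bracket and the
  derivative of the adjoint representation are $H(x,y)-H(y,x)$.\<close>
definition mult_hessian :: "'g monoid \<Rightarrow> ('g, 'a::real_normed_vector) chart set \<Rightarrow> 'a \<Rightarrow> 'a \<Rightarrow> 'a"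
  where "mult_hessian G A x y =
     frechet_derivative (\<lambda>\<zeta>. mult_deriv G A \<zeta> (0, y)) (at (unit_coord G A, unit_coord G A)) (x, 0)"

lemma unit_chart:
  assumes "lie_group G A"
  shows "unit_chart G A \<in> A" "valid_chart (unit_chart G A)" "\<one>\<^bsub>G\<^esub> \<in> fst (unit_chart G A)"
    "unit_coord G A \<in> snd (unit_chart G A) ` fst (unit_chart G A)" "chart_inv (unit_chart G A) (unit_coord G A) = \<one>\<^bsub>G\<^esub>"
proof -
  note M = lie_groupD(3)[OF assms]
  show *: "unit_chart G A \<in> A" "\<one>\<^bsub>G\<^esub> \<in> fst (unit_chart G A)" "valid_chart (unit_chart G A)"
    using smooth_manifold_charts[OF M] by (auto simp: unit_chart_def)
  show "unit_coord G A \<in> snd (unit_chart G A) ` fst (unit_chart G A)" "chart_inv (unit_chart G A) (unit_coord G A) = \<one>\<^bsub>G\<^esub>"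
    using * valid_chart_inverse(1)[OF *(3)] by (auto simp: unit_coord_def)
qed

lemma open_mult_domain:
  assumes "lie_group G A"
  shows "open (mult_domain G A)"
proof -
  let ?c = "unit_chart G A"
  have "continuous_on UNIV (mult_map G)" "open (fst ?c)"
    using lie_groupD(4)[OF assms] unit_chart(2)[OF assms] by (auto simp: smooth_map_def valid_chart_def)
  then have "open (mult_map G -` fst ?c)"
    by (simp add: open_vimage)
  then show ?thesis
    unfolding mult_domain_def Let_def
    by (intro valid_chart_open_image valid_prod_chart unit_chart[OF assms])
qed

lemma axes_in_mult_domain:
  assumes G: "lie_group G A" and g: "g \<in> fst (unit_chart G A)"
  shows "(snd (unit_chart G A) g, unit_coord G A) \<in> mult_domain G A"
    "(unit_coord G A, snd (unit_chart G A) g) \<in> mult_domain G A"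
  using g unit_chart(3)[OF G] lie_group_cancel(1,2)[OF G]
  by (force simp: mult_domain_def Let_def unit_coord_def image_iff)+

lemma smooth_mult_rep:
  assumes "lie_group G A"
  shows "smooth_on (mult_domain G A) (mult_rep G A)"
  using lie_groupD(4)[OF assms] prod_chart_in_prod_atlas[OF unit_chart(1)[OF assms] unit_chart(1)[OF assms]] unit_chart(1)[OF assms]
  unfolding smooth_map_def mult_domain_def mult_rep_def Let_def by blast

lemma mult_deriv_smooth:
  assumes "lie_group G A" "\<zeta> \<in> mult_domain G A"
  shows "(mult_rep G A has_derivative mult_deriv G A \<zeta>) (at \<zeta>)"
    "smooth_on (mult_domain G A) (\<lambda>\<zeta>. mult_deriv G A \<zeta> u)"
  using smooth_on_has_derivative[OF smooth_mult_rep[OF assms(1)] assms(2)]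
    smooth_on_directional_derivative[OF smooth_mult_rep[OF assms(1)]]
  by (simp_all add: mult_deriv_def)

text \<open>The bracket of left-invariant fields differentiates left translations along the first factor;
  the adjoint representation also brings in right translations differentiated along the second
  factor. Schwarz's theorem expresses both by the same Hessian.\<close>
lemma mult_hessian_alt:
  assumes G: "lie_group G A"
  shows "frechet_derivative (\<lambda>\<zeta>. mult_deriv G A \<zeta> (x, 0)) (at (unit_coord G A, unit_coord G A)) (0, y) = mult_hessian G A x y"
proof -
  let ?P = "(unit_coord G A, unit_coord G A)"
  have P: "?P \<in> mult_domain G A"
    using axes_in_mult_domain(1)[OF G unit_chart(3)[OF G]] by (simp add: unit_coord_def)
  note sm = mult_deriv_smooth(2)[OF G P]
  have cont: "isCont (\<lambda>z. frechet_derivative (\<lambda>\<zeta>. mult_deriv G A \<zeta> u) (at z) v) ?P" for u v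
    using smooth_on_imp_continuous_on[OF smooth_on_directional_derivative[OF sm]] open_mult_domain[OF G] P
    by (metis continuous_on_eq_continuous_at)
  show ?thesis
    unfolding mult_hessian_def
    by (rule mixed_derivatives_commute[OF open_mult_domain[OF G] P mult_deriv_smooth(1)[OF G]
          smooth_on_has_derivative[OF sm] smooth_on_has_derivative[OF sm] cont cont])
qed

lemma left_translation_unit_chart:
  assumes G: "lie_group G A" and g: "g \<in> fst (unit_chart G A)"
  shows "has_chart_derivative (unit_chart G A) (unit_chart G A) (\<lambda>h. g \<otimes>\<^bsub>G\<^esub> h) \<one>\<^bsub>G\<^esub>
     (\<lambda>v. mult_deriv G A (snd (unit_chart G A) g, unit_coord G A) (0, v))"
proof -
  let ?c = "unit_chart G A"
  note c = unit_chart[OF G]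
  have "g \<otimes>\<^bsub>G\<^esub> \<one>\<^bsub>G\<^esub> \<in> fst ?c" using g lie_group_cancel(2)[OF G] by simp
  from has_chart_derivative_chain[OF c(2) valid_prod_chart[OF c(2) c(2)]
      has_chart_derivative_Pair[OF has_chart_derivative_const[OF c(3) g] has_chart_derivative_ident[OF c(2,3)]]
      mult_has_chart_derivative[OF G c(1) c(1) c(1) g c(3) this]]
  show ?thesis by (simp add: o_def mult_deriv_def mult_rep_def unit_coord_def)
qed

lemma right_translation_unit_chart:
  assumes G: "lie_group G A" and g: "g \<in> fst (unit_chart G A)"
  shows "has_chart_derivative (unit_chart G A) (unit_chart G A) (\<lambda>h. h \<otimes>\<^bsub>G\<^esub> g) \<one>\<^bsub>G\<^esub>
     (\<lambda>v. mult_deriv G A (unit_coord G A, snd (unit_chart G A) g) (v, 0))"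
proof -
  let ?c = "unit_chart G A"
  note c = unit_chart[OF G]
  have "\<one>\<^bsub>G\<^esub> \<otimes>\<^bsub>G\<^esub> g \<in> fst ?c" using g lie_group_cancel(1)[OF G] by simp
  from has_chart_derivative_chain[OF c(2) valid_prod_chart[OF c(2) c(2)]
      has_chart_derivative_Pair[OF has_chart_derivative_ident[OF c(2,3)] has_chart_derivative_const[OF c(3) g]]
      mult_has_chart_derivative[OF G c(1) c(1) c(1) c(3) g this]]
  show ?thesis by (simp add: o_def mult_deriv_def mult_rep_def unit_coord_def)
qed

lemma mult_deriv_unit:
  assumes G: "lie_group G A"
  shows "mult_deriv G A (unit_coord G A, unit_coord G A) (v, 0) = v"
    "mult_deriv G A (unit_coord G A, unit_coord G A) (0, v) = v"
proof -
  note c = unit_chart[OF G]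
  have id: "has_chart_derivative (unit_chart G A) (unit_chart G A) (\<lambda>h. h) \<one>\<^bsub>G\<^esub> (\<lambda>v. v)"
    by (rule has_chart_derivative_ident[OF c(2,3)])
  show "mult_deriv G A (unit_coord G A, unit_coord G A) (v, 0) = v"
    using fun_cong[OF has_chart_derivative_unique[OF right_translation_unit_chart[OF G c(3), unfolded lie_group_cancel(2)[OF G]] id], of v]
    by (simp add: unit_coord_def)
  show "mult_deriv G A (unit_coord G A, unit_coord G A) (0, v) = v"
    using fun_cong[OF has_chart_derivative_unique[OF left_translation_unit_chart[OF G c(3), unfolded lie_group_cancel(1)[OF G]] id], of v]
    by (simp add: unit_coord_def)
qed

text \<open>The preferred chart at $g$ enters through the value of the left-invariant field and through its
  transport to the chart around the unit; the chain rule cancels it, leaving the derivative of the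
  multiplication in one fixed chart, which can be differentiated in $g$.\<close>
lemma field_rep_left_inv_field:
  assumes G: "lie_group G A" and g: "g \<in> fst (unit_chart G A)"
  shows "field_rep A (unit_chart G A) (left_inv_field G A x) (snd (unit_chart G A) g) =
    mult_deriv G A (snd (unit_chart G A) g, unit_coord G A) (0, x)"
proof -
  let ?c = "unit_chart G A" and ?d = "chart_at A g"
  note c = unit_chart[OF G]
  note M = lie_groupD(3)[OF G]
  note ch = smooth_manifold_charts[OF M]
  have "\<exists>S. has_chart_derivative ?c ?d (\<lambda>h. g \<otimes>\<^bsub>G\<^esub> h) \<one>\<^bsub>G\<^esub> S"
    using translations_have_chart_derivative(1)[OF G c(1) ch(2) c(3)] ch(3) lie_group_cancel(2)[OF G] by metis
  then have S: "has_chart_derivative ?c ?d (\<lambda>h. g \<otimes>\<^bsub>G\<^esub> h) \<one>\<^bsub>G\<^esub> (mderiv A A (\<lambda>h. g \<otimes>\<^bsub>G\<^esub> h) \<one>\<^bsub>G\<^esub>)"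
    using has_chart_derivative_mderiv[where A=A and B=A and p="\<one>\<^bsub>G\<^esub>" and F="\<lambda>h. g \<otimes>\<^bsub>G\<^esub> h"] lie_group_cancel(2)[OF G]
    by (auto simp: unit_chart_def)
  have "has_chart_derivative ?d ?c (\<lambda>x. x) g (to_chart A ?c g)"
    using transition_has_chart_derivative[OF M ch(2) c(1) ch(3) g] by (simp add: to_chart_def)
  then have "has_chart_derivative ?c ?c (\<lambda>h. g \<otimes>\<^bsub>G\<^esub> h) \<one>\<^bsub>G\<^esub> (to_chart A ?c g \<circ> mderiv A A (\<lambda>h. g \<otimes>\<^bsub>G\<^esub> h) \<one>\<^bsub>G\<^esub>)"
    using has_chart_derivative_chain[OF c(2) ch(1)[OF ch(2)] S] lie_group_cancel(2)[OF G] by simp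
  from has_chart_derivative_unique[OF this left_translation_unit_chart[OF G g]]
  show ?thesis
    using valid_chart_inverse(1)[OF c(2) g]
    by (simp add: field_rep_def left_inv_field_def fun_eq_iff)
qed

lemma lie_bracket_eq_hessian:
  assumes G: "lie_group G A"
  shows "lie_bracket G A x y = mult_hessian G A x y - mult_hessian G A y x"
proof -
  let ?c = "unit_chart G A" and ?e = "unit_coord G A"
  note c = unit_chart[OF G]
  have P: "(?e, ?e) \<in> mult_domain G A"
    using axes_in_mult_domain(1)[OF G c(3)] by (simp add: unit_coord_def)
  have D: "frechet_derivative (field_rep A ?c (left_inv_field G A y)) (at ?e) x = mult_hessian G A x y" for x y
  proof -
    have "((\<lambda>\<xi>. (\<xi>, ?e)) has_derivative (\<lambda>v. (v, 0))) (at ?e)"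
      by (auto intro!: derivative_eq_intros)
    from has_derivative_compose[OF this smooth_on_has_derivative[OF mult_deriv_smooth(2)[OF G P] P]]
    have "((\<lambda>\<xi>. mult_deriv G A (\<xi>, ?e) (0, y)) has_derivative (\<lambda>v. mult_hessian G A v y)) (at ?e)"
      by (simp add: mult_hessian_def)
    then have "(field_rep A ?c (left_inv_field G A y) has_derivative (\<lambda>v. mult_hessian G A v y)) (at ?e)"
    proof (rule has_derivative_transform_within_open)
      show "open (snd ?c ` fst ?c)" using c(2) by (simp add: valid_chart_def)
    qed (use c(4) field_rep_left_inv_field[OF G] in auto)
    then show ?thesis
      using frechet_derivative_at by metis
  qed
  have "has_chart_derivative ?c ?c (\<lambda>h. \<one>\<^bsub>G\<^esub> \<otimes>\<^bsub>G\<^esub> h) \<one>\<^bsub>G\<^esub> (\<lambda>v. v)"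
    using has_chart_derivative_ident[OF c(2,3)] lie_group_cancel(1)[OF G] by simp
  then have "mderiv A A (\<lambda>h. \<one>\<^bsub>G\<^esub> \<otimes>\<^bsub>G\<^esub> h) \<one>\<^bsub>G\<^esub> = (\<lambda>v. v)"
    by (intro mderiv_eqI) (simp add: unit_chart_def lie_group_cancel[OF G])
  then have "left_inv_field G A x \<one>\<^bsub>G\<^esub> = x" for x
    by (simp add: left_inv_field_def)
  with D show ?thesis
    by (simp add: lie_bracket_def field_bracket_def unit_chart_def[symmetric] unit_coord_def[symmetric])
qed

section \<open>The adjoint representation\<close>

text \<open>The identity $(ghg^{-1})\,g = g\,h$ differentiated in $h$ at the unit. It characterizes
  $\mathrm{Ad}_g x$ by a linear equation whose coefficients are first derivatives of the
  multiplication alone.\<close>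
lemma Ad_translation_equation:
  assumes G: "lie_group G A" and g: "g \<in> fst (unit_chart G A)"
  shows "mult_deriv G A (unit_coord G A, snd (unit_chart G A) g) (Ad G A g x, 0) =
     mult_deriv G A (snd (unit_chart G A) g, unit_coord G A) (0, x)"
proof -
  let ?c = "unit_chart G A" and ?d = "chart_at A g"
  note c = unit_chart[OF G]
  note M = lie_groupD(3)[OF G]
  note ch = smooth_manifold_charts[OF M]
  note cancel = lie_group_cancel[OF G]
  obtain S where S: "has_chart_derivative ?c ?d (\<lambda>h. g \<otimes>\<^bsub>G\<^esub> h) \<one>\<^bsub>G\<^esub> S"
    using translations_have_chart_derivative(1)[OF G c(1) ch(2) c(3)] ch(3) cancel(2) by metis
  obtain T where T: "has_chart_derivative ?d ?c (\<lambda>h. h \<otimes>\<^bsub>G\<^esub> inv\<^bsub>G\<^esub> g) g T"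
    using translations_have_chart_derivative(2)[OF G ch(2) c(1) ch(3)] c(3) cancel(5) by metis
  have 1: "has_chart_derivative ?c ?c (\<lambda>h. g \<otimes>\<^bsub>G\<^esub> h \<otimes>\<^bsub>G\<^esub> inv\<^bsub>G\<^esub> g) \<one>\<^bsub>G\<^esub> (T \<circ> S)"
    using has_chart_derivative_chain[OF c(2) ch(1)[OF ch(2)] S] T cancel(2) by simp
  then have "Ad G A g = T \<circ> S"
    unfolding Ad_def by (intro mderiv_eqI) (simp add: cancel unit_chart_def)
  with 1 have 2: "has_chart_derivative ?c ?c (\<lambda>h. g \<otimes>\<^bsub>G\<^esub> h \<otimes>\<^bsub>G\<^esub> inv\<^bsub>G\<^esub> g) \<one>\<^bsub>G\<^esub> (Ad G A g)" by simp
  have "has_chart_derivative ?c ?c (\<lambda>h. g \<otimes>\<^bsub>G\<^esub> h) \<one>\<^bsub>G\<^esub>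
     ((\<lambda>v. mult_deriv G A (unit_coord G A, snd ?c g) (v, 0)) \<circ> Ad G A g)"
    using has_chart_derivative_chain[OF c(2) c(2) 2, of ?c "\<lambda>h. h \<otimes>\<^bsub>G\<^esub> g"]
      right_translation_unit_chart[OF G g] by (simp add: cancel)
  from fun_cong[OF has_chart_derivative_unique[OF this left_translation_unit_chart[OF G g]], of x]
  show ?thesis by simp
qed

lemma Ad_unit:
  assumes G: "lie_group G A"
  shows "Ad G A \<one>\<^bsub>G\<^esub> x = x"
  using Ad_translation_equation[OF G unit_chart(3)[OF G], of x] mult_deriv_unit[OF G]
  by (simp add: unit_coord_def)

text \<open>The derivative of $\mathrm{Ad}$ at the unit in direction $z$ is $x\mapsto[z,x]$. On the coordinate
  line $e+tz$, the equation for $\mathrm{Ad}_g x$ reads $R_t(\mathrm{Ad}_{g_t}x)=l_t$ with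
  $R_t v=D_{(v,0)}m(e,e+tz)$ and $l_t=D_{(0,x)}m(e+tz,e)$. Here $R'(v)=H(v,z)$, by Schwarz's theorem, and
  $l'=H(z,x)$, so the derivative is $H(z,x)-H(x,z)$.\<close>
lemma Ad_has_vector_derivative:
  fixes A :: "('g::{t2_space,second_countable_topology}, 'a::real_normed_vector) chart set"
  assumes G: "lie_group G A"
  shows "((\<lambda>t. Ad G A (chart_inv (unit_chart G A) (unit_coord G A + t *\<^sub>R z)) x)
     has_vector_derivative lie_bracket G A z x) (at 0)"
proof -
  let ?c = "unit_chart G A" and ?e = "unit_coord G A"
  note c = unit_chart[OF G]
  have P: "(?e, ?e) \<in> mult_domain G A"
    using axes_in_mult_domain(1)[OF G c(3)] by (simp add: unit_coord_def)
  obtain B0 where B0: "finite B0" "span B0 = (UNIV :: 'a set)"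
    using lie_groupD(3)[OF G] unfolding smooth_manifold_def by auto
  have line: "((\<lambda>t. ?e + t *\<^sub>R z) has_derivative (\<lambda>t. t *\<^sub>R z)) (at 0)"
    by (auto intro!: derivative_eq_intros)
  have "((\<lambda>t. ?e + t *\<^sub>R z) \<longlongrightarrow> ?e + 0 *\<^sub>R z) (at 0)"
    by (intro tendsto_intros)
  then have "\<forall>\<^sub>F t in at 0. ?e + t *\<^sub>R z \<in> snd ?c ` fst ?c"
    using c(2,4) by (auto simp: valid_chart_def dest: topological_tendstoD)
  then have ev: "\<forall>\<^sub>F t in at 0. \<exists>g\<in>fst ?c. snd ?c g = ?e + t *\<^sub>R z \<and> chart_inv ?c (?e + t *\<^sub>R z) = g"
    by eventually_elim (use valid_chart_inverse[OF c(2)] in auto)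
  have hess: "((\<lambda>t. mult_deriv G A (\<gamma> t) u) has_vector_derivative
      frechet_derivative (\<lambda>\<zeta>. mult_deriv G A \<zeta> u) (at (?e, ?e)) w) (at 0)"
    if "(\<gamma> has_derivative (\<lambda>t. t *\<^sub>R w)) (at 0)" "\<gamma> 0 = (?e, ?e)" for \<gamma> u w
  proof -
    note d = smooth_on_has_derivative[OF mult_deriv_smooth(2)[OF G P, of u] P]
    have "((\<lambda>t. mult_deriv G A (\<gamma> t) u) has_derivative
        (\<lambda>t. frechet_derivative (\<lambda>\<zeta>. mult_deriv G A \<zeta> u) (at (?e, ?e)) (t *\<^sub>R w))) (at 0)"
      by (rule has_derivative_compose[OF that(1)]) (simp add: that(2) d)
    then show ?thesis
      by (simp add: has_vector_derivative_def linear_scale[OF has_derivative_linear[OF d]])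
  qed
  have dR: "((\<lambda>t. mult_deriv G A (?e, ?e + t *\<^sub>R z) (v, 0)) has_vector_derivative mult_hessian G A v z) (at 0)" for v
    unfolding mult_hessian_alt[OF G, symmetric]
    by (rule hess) (use has_derivative_Pair[OF has_derivative_const line] in auto)
  have dl: "((\<lambda>t. mult_deriv G A (?e + t *\<^sub>R z, ?e) (0, x)) has_vector_derivative mult_hessian G A z x) (at 0)"
    unfolding mult_hessian_def
    by (rule hess) (use has_derivative_Pair[OF line has_derivative_const] in auto)
  have "((\<lambda>t. Ad G A (chart_inv ?c (?e + t *\<^sub>R z)) x) has_vector_derivative
       (mult_hessian G A z x - mult_hessian G A x z)) (at 0)"
  proof (rule has_vector_derivative_solution_of_linear_equation[OF B0 _ _ dR dl])
    show "\<forall>\<^sub>F t in at 0. linear (\<lambda>v. mult_deriv G A (?e, ?e + t *\<^sub>R z) (v, 0))"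
      using ev
    proof eventually_elim
      case (elim t)
      then obtain g where "g \<in> fst ?c" "snd ?c g = ?e + t *\<^sub>R z" by auto
      then show ?case
        using has_chart_derivative_linear[OF right_translation_unit_chart[OF G]] by metis
    qed
    show "\<forall>\<^sub>F t in at 0. mult_deriv G A (?e, ?e + t *\<^sub>R z) (Ad G A (chart_inv ?c (?e + t *\<^sub>R z)) x, 0) =
        mult_deriv G A (?e + t *\<^sub>R z, ?e) (0, x)"
      using ev by eventually_elim (use Ad_translation_equation[OF G] in metis)
    show "Ad G A (chart_inv ?c (?e + 0 *\<^sub>R z)) x = x"
      by (simp add: c(5) Ad_unit[OF G])
  qed (simp_all add: mult_deriv_unit[OF G])
  then show ?thesis
    by (simp add: lie_bracket_eq_hessian[OF G])
qed

section \<open>Nondegeneracy\<close>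

text \<open>Infinitesimal $\mathrm{Ad}$-invariance: differentiate the constant function
  $t\mapsto\langle\mathrm{Ad}_{g_t}x,\mathrm{Ad}_{g_t}y\rangle$ at $t=0$.\<close>
lemma lie_bracket_skew_adjoint:
  fixes A :: "('g::{t2_space,second_countable_topology}, 'a::real_normed_vector) chart set"
  assumes G: "lie_group G A" and ip: "Ad_invariant_inner_product G A ip"
  shows "ip (lie_bracket G A z x) y + ip x (lie_bracket G A z y) = 0"
proof -
  let ?g = "\<lambda>t. chart_inv (unit_chart G A) (unit_coord G A + t *\<^sub>R z)"
  obtain B0 where B0: "finite B0" "span B0 = (UNIV :: 'a set)"
    using lie_groupD(3)[OF G] unfolding smooth_manifold_def by auto
  have bil: "bilinear ip" and inv: "\<And>g x y. ip (Ad G A g x) (Ad G A g y) = ip x y"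
    using ip by (auto simp: Ad_invariant_inner_product_def)
  have "Ad G A (?g 0) x = x" for x
    by (simp add: unit_chart(5)[OF G] Ad_unit[OF G])
  then have "((\<lambda>t. ip (Ad G A (?g t) x) (Ad G A (?g t) y)) has_real_derivative
      (ip (lie_bracket G A z x) y + ip x (lie_bracket G A z y))) (at 0)"
    using has_real_derivative_bilinear[OF B0 bil Ad_has_vector_derivative[OF G, of z x] Ad_has_vector_derivative[OF G, of z y]]
    by simp
  then have "((\<lambda>t::real. ip x y) has_real_derivative (ip (lie_bracket G A z x) y + ip x (lie_bracket G A z y))) (at 0)"
    by (simp add: inv)
  then show ?thesis
    using DERIV_const DERIV_unique by blast
qed

lemma lie_bracket_antisym:
  assumes G: "lie_group G A"
  shows "lie_bracket G A y x = - lie_bracket G A x y"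
  by (simp add: lie_bracket_eq_hessian[OF G])

text \<open>The multiples of a central element form an abelian ideal, which a semisimple Lie algebra allows
  only for the zero vector.\<close>
lemma central_element_eq_0:
  assumes G: "lie_group G A" and ss: "semisimple G A"
    and central: "\<And>c y. lie_bracket G A y (c *\<^sub>R x) = 0"
  shows "x = 0"
proof -
  have sp: "span {x} = range (\<lambda>c. c *\<^sub>R x)"
    by (rule span_singleton)
  have "lie_ideal G A (span {x})"
    using central by (auto simp: lie_ideal_def sp subspace_span[of "{x}", unfolded sp] intro!: range_eqI[of _ _ 0])
  moreover have "derived_series G A (span {x}) 1 = {0}"
  proof -
    have "{lie_bracket G A u v | u v. u \<in> span {x} \<and> v \<in> span {x}} = {0}"
    proof (intro equalityI)
      show "{lie_bracket G A u v | u v. u \<in> span {x} \<and> v \<in> span {x}} \<subseteq> {0}"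
        using central by (auto simp: sp)
      have "lie_bracket G A 0 0 = 0" using central[of 0 0] by simp
      then show "{0} \<subseteq> {lie_bracket G A u v | u v. u \<in> span {x} \<and> v \<in> span {x}}"
        using span_zero by force
    qed
    then show ?thesis by (simp add: span_insert_0)
  qed
  ultimately have "span {x} = {0}"
    using ss unfolding semisimple_def by blast
  then show ?thesis
    using span_base[of x "{x}"] by auto
qed

text \<open>By skew-adjointness the three cyclic terms in the definition of $\eta_G$ agree, and
  $[\theta^L,\theta^L](v,w)=2[\theta^L v,\theta^L w]$; thus $\frac1{12}\cdot3\cdot2=\frac12$.\<close>
lemma cartan_form_eq:
  assumes G: "lie_group G A" and ip: "Ad_invariant_inner_product G A ip"
  shows "cartan_form G A ip g [u, v, w] =
    1/2 * ip (theta_L G A g u) (lie_bracket G A (theta_L G A g v) (theta_L G A g w))"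
proof -
  let ?b = "lie_bracket G A"
  have bil: "bilinear ip" and sym: "\<And>x y. ip x y = ip y x"
    using ip by (auto simp: Ad_invariant_inner_product_def)
  have double: "theta_bracket G A g v w = 2 *\<^sub>R ?b (theta_L G A g v) (theta_L G A g w)" for v w
    using lie_bracket_antisym[OF G, of "theta_L G A g w" "theta_L G A g v"]
    by (simp add: theta_bracket_def scaleR_2)
  have cyc: "ip y (?b z x) = ip x (?b y z)" for x y z
    using lie_bracket_skew_adjoint[OF G ip, of z x y] lie_bracket_antisym[OF G, of z y] sym bilinear_rneg[OF bil]
    by (metis add_eq_0_iff add.inverse_inverse add.commute)
  show ?thesis
    using cyc[of "theta_L G A g v" "theta_L G A g w" "theta_L G A g u"]
      cyc[of "theta_L G A g w" "theta_L G A g u" "theta_L G A g v"]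
    by (simp add: cartan_form_def double bilinear_rmul[OF bil])
qed

text \<open>If $\iota_u\eta_G=0$ at $g$, then $X=\theta^L u$ is orthogonal to every bracket, so
  $\langle[y,X],w\rangle=-\langle X,[y,w]\rangle=0$ for all $y$ and $w$. Hence $X$ is central and
  vanishes.\<close>
theorem nondegenerate_cartan_form:
  assumes G: "lie_group G A" and ss: "semisimple G A" and ip: "Ad_invariant_inner_product G A ip"
  shows "nondegenerate_form (cartan_form G A ip)"
  unfolding nondegenerate_form_def
proof (intro allI impI)
  fix g u assume u: "\<forall>vs. cartan_form G A ip g (u # vs) = 0"
  let ?\<theta> = "theta_L G A g" and ?b = "lie_bracket G A"
  have bil: "bilinear ip" and sym: "\<And>x y. ip x y = ip y x" and pos: "\<And>x. x \<noteq> 0 \<Longrightarrow> ip x x > 0"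
    using ip by (auto simp: Ad_invariant_inner_product_def)
  have orth: "ip (?\<theta> u) (?b y z) = 0" for y z
  proof -
    obtain v w where "y = ?\<theta> v" "z = ?\<theta> w"
      using theta_L_bijective(2)[OF G] by (metis bij_pointE)
    then show ?thesis
      using u[rule_format, of "[v, w]"] by (simp add: cartan_form_eq[OF G ip])
  qed
  have "?b y (c *\<^sub>R ?\<theta> u) = 0" for c y
  proof -
    let ?w = "?b y (c *\<^sub>R ?\<theta> u)"
    have "ip ?w ?w = - (c * ip (?\<theta> u) (?b y ?w))"
      using lie_bracket_skew_adjoint[OF G ip, of y "c *\<^sub>R ?\<theta> u" ?w] by (simp add: bilinear_lmul[OF bil])
    then show ?thesis
      using pos[of ?w] orth by auto
  qed
  then have "?\<theta> u = 0"
    by (rule central_element_eq_0[OF G ss])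
  then show "u = 0"
    using theta_L_bijective[OF G, of g] by (metis bij_is_inj injD linear_0)
qed


text \<open>For either notion the condition on $\alpha$ forces the component in $N$ to vanish, that is
  $dF(w)=0$; the condition on $\beta$ then places $w$ in both kernels. In particular the two notions
  coincide because each of them holds.\<close>
lemma strongly_and_weakly_nondegenerate_if_kernels_meet_trivially:
  assumes nondeg: "nondegenerate_form \<alpha>"
    and min: "\<And>m. {w. \<forall>vs. \<beta> m (w # vs) = 0} \<inter> {w. mderiv A B F m w = 0} = {0}"
  shows "weakly_nondegenerate A B F (\<alpha>, \<beta>)" and "strongly_nondegenerate A B F (\<alpha>, \<beta>)"
proof -
  have zero: "w = 0" if "mderiv A B F m w = 0" "\<forall>vs. \<beta> m (w # vs) = 0" for m w
    using min[of m] that by blast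
  show "weakly_nondegenerate A B F (\<alpha>, \<beta>)"
    using nondeg zero by (auto simp: weakly_nondegenerate_def nondegenerate_form_def)
  show "strongly_nondegenerate A B F (\<alpha>, \<beta>)"
    unfolding strongly_nondegenerate_def
  proof (intro allI impI)
    fix v assume v: "rel_pair A B F v \<and> rel_contract v (\<alpha>, \<beta>) = ((\<lambda>_ _. 0), (\<lambda>_ _. 0))"
    then have "\<forall>p vs. \<alpha> p (fst v p # vs) = 0" and ker: "\<forall>m vs. \<beta> m (snd v m # vs) = 0"
      by (auto simp: rel_contract_def contract_def fun_eq_iff)
    then have "fst v p = 0" for p
      using nondeg unfolding nondegenerate_form_def by blast
    moreover from this have "snd v m = 0" for m
      using v ker by (intro zero[of m]) (auto simp: rel_pair_def)
    ultimately show "v = ((\<lambda>_. 0), (\<lambda>_. 0))"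
      by (simp add: prod_eq_iff fun_eq_iff)
  qed
qed

theorem corollary9p14:
  fixes G :: "'g::{t2_space,second_countable_topology} monoid"
    and A :: "('g, 'a::real_normed_vector) chart set"
    and ip :: "'a \<Rightarrow> 'a \<Rightarrow> real"
    and B :: "('m::{t2_space,second_countable_topology}, 'e::real_normed_vector) chart set"
    and act :: "'g \<Rightarrow> 'm \<Rightarrow> 'm"
    and \<omega> :: "('m, 'e) form"
    and \<mu> :: "'m \<Rightarrow> 'g"
  assumes "lie_group G A"
    and "compact (UNIV :: 'g set)"
    and "connected (UNIV :: 'g set)"
    and "semisimple G A"
    and "Ad_invariant_inner_product G A ip"
    and "quasi_hamiltonian G A ip B act \<omega> \<mu>"
  shows "nondegenerate_form (cartan_form G A ip) \<and>
    (weakly_nondegenerate B A \<mu> (cartan_form G A ip, \<omega>) \<longleftrightarrow>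
     strongly_nondegenerate B A \<mu> (cartan_form G A ip, \<omega>))"
proof -
  have nondeg: "nondegenerate_form (cartan_form G A ip)"
    by (rule nondegenerate_cartan_form[OF assms(1,4,5)])
  moreover have "{w. \<forall>vs. \<omega> m (w # vs) = 0} \<inter> {w. mderiv B A \<mu> m w = 0} = {0}" for m
    using assms(6) by (simp add: quasi_hamiltonian_def)
  ultimately show ?thesis
    using strongly_and_weakly_nondegenerate_if_kernels_meet_trivially
      [of "cartan_form G A ip" \<omega> B A \<mu>] by simp
qed

end
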